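(* (Forgetting components.) Let $C\subset(\mathbb{C}^2,0)$ be a reduced plane curve germ with $r\ge1$ irreducible components, and let $C_1$ be an irreducible plane curve germ such that $C\cup C_1$ is a reduced curve with $r+1$ components (the variable $t_{r+1}$ corresponding to $C_1$). Then $$\overline{P}_{g}^{\,C\cup C_1}(t_1,\ldots,t_{r},t_{r+1}=1)=(1-q)\,\overline{P}_{g}^{\,C}(t_1,\ldots,t_r).$$ Moreover, if $C$ has only one component, then $\overline{P}_{g}^{\,C}(t=1)=1$.
   Context: For a reduced plane curve germ $C=\bigcup_{k=1}^rC_k$ let $\gamma_k:(\mathbb{C},0)\to(C_k,0)$ be uniformizations of the components, $\mathcal{O}=\mathcal{O}_{\mathbb{C}^2,0}$, $v_k(f)=\mathrm{ord}_0 f(\gamma_k(t))$, and for $\underline v\in\mathbb{Z}^r$ let $J_{\underline v}=\{f\in\mathcal{O}: v_k(f)\ge v_k \ \forall k\}$, $h(\underline v)=\dim_{\mathbb{C}}\mathcal{O}/J_{\underline v}$. Let $q$ be a formal variable (corresponding to $\mathbb{L}^{-1}$). Put $L_g=\sum_{\underline v\in\mathbb{Z}^r}\frac{q^{h(\underline v)}-q^{h(\underline v+\underline 1)}}{1-q}t_1^{v_1}\cdots t_r^{v_r}$ and $$P_g^C(t_1,\dots,t_r)=\frac{L_g\cdot\prod_{k=1}^r(t_k-1)}{t_1\cdots t_r-1}$$ (the product in the numerator is taken coefficientwise and is a power series). Equivalently, the coefficient of $t^{\underline v}$, $\underline v\in\mathbb{Z}_{\ge0}^r$, in $P_g^C$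 is $\frac1{1-q}\sum_{J\subset\{1,\dots,r\}}(-1)^{|J|}q^{h(\underline v+e_J)}$, $e_J=\sum_{k\in J}e_k$; this is the motivic integral $\int_{\mathbb{P}\mathcal{O}}t_1^{v_1}\cdots t_r^{v_r}d\mu$. The reduced motivic Poincaré series is $\overline{P}_g^C=P_g^C\cdot\prod_{k=1}^r(1-qt_k)$; it is a polynomial in $t_1,\dots,t_r$ and $q$. *)

theory Defs
  imports "HOL-Complex_Analysis.Complex_Analysis" "HOL-Library.Poly_Mapping"
begin

section \<open>The local ring of convergent power series in two variables\<close>

text \<open>
  The series \<open>\<Sum> a\<^sub>i\<^sub>j x^i y^j\<close> is represented by \<open>a :: complex fps fps\<close> with
  \<open>a\<^sub>i\<^sub>j = a $ i $ j\<close>; the ring of germs of holomorphic functions at the origin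
  of the complex plane \<open>complex \<times> complex\<close> consists of the series that converge absolutely
  on some polydisc.
\<close>

definition convergent2 :: "complex fps fps \<Rightarrow> bool" where
  "convergent2 a \<longleftrightarrow>
     (\<exists>\<rho>>0. (\<lambda>(i, j). norm (a $ i $ j) * \<rho> ^ i * \<rho> ^ j) summable_on (UNIV :: (nat \<times> nat) set))"

lemma convergent2_iff_bound:
  "convergent2 a \<longleftrightarrow> (\<exists>M R. 0 < R \<and> (\<forall>i j. norm (a $ i $ j) \<le> M * R ^ (i + j)))"
proof
  assume "convergent2 a"
  then obtain \<rho> where \<rho>: "\<rho> > 0"
    and s: "(\<lambda>(i, j). norm (a $ i $ j) * \<rho> ^ i * \<rho> ^ j) summable_on (UNIV :: (nat \<times> nat) set)"
    by (auto simp: convergent2_def)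
  define M where
    "M = infsum (\<lambda>(i, j). norm (a $ i $ j) * \<rho> ^ i * \<rho> ^ j) (UNIV :: (nat \<times> nat) set)"
  have "norm (a $ i $ j) \<le> M * (1 / \<rho>) ^ (i + j)" for i j
  proof -
    have "sum (\<lambda>(i, j). norm (a $ i $ j) * \<rho> ^ i * \<rho> ^ j) {(i, j)} \<le> M"
      unfolding M_def by (rule finite_sum_le_infsum[OF s]) (use \<rho> in auto)
    then have "norm (a $ i $ j) * \<rho> ^ (i + j) \<le> M"
      by (simp add: power_add mult.assoc)
    with \<rho> show ?thesis
      by (simp add: power_divide field_simps)
  qed
  with \<rho> show "\<exists>M R. 0 < R \<and> (\<forall>i j. norm (a $ i $ j) \<le> M * R ^ (i + j))"
    by (intro exI[of _ M] exI[of _ "1 / \<rho>"]) auto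
next
  assume "\<exists>M R. 0 < R \<and> (\<forall>i j. norm (a $ i $ j) \<le> M * R ^ (i + j))"
  then obtain M R where R: "0 < R" and b: "\<And>i j. norm (a $ i $ j) \<le> M * R ^ (i + j)"
    by blast
  define \<rho> where "\<rho> = 1 / (2 * R)"
  have \<rho>: "\<rho> > 0" using R by (simp add: \<rho>_def)
  have geo: "(\<lambda>i. (1 / 2 :: real) ^ i) summable_on UNIV"
    by (subst summable_on_UNIV_nonneg_real_iff) (auto intro: summable_geometric)
  have "(\<lambda>(i, j). (1 / 2 :: real) ^ i * (1 / 2) ^ j) summable_on (UNIV \<times> UNIV)"
    by (rule summable_on_SigmaI[where g = "\<lambda>i. (1 / 2 :: real) ^ i * infsum (\<lambda>j. (1 / 2) ^ j) UNIV"])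
      (auto intro!: has_sum_cmult_right summable_on_cmult_left geo has_sum_infsum)
  then have "(\<lambda>p. M * (\<lambda>(i, j). (1 / 2 :: real) ^ i * (1 / 2) ^ j) p) summable_on UNIV"
    by (intro summable_on_cmult_right) simp
  then have "(\<lambda>(i, j). norm (a $ i $ j) * \<rho> ^ i * \<rho> ^ j) summable_on (UNIV :: (nat \<times> nat) set)"
  proof (rule summable_on_comparison_test)
    fix p :: "nat \<times> nat"
    obtain i j where p: "p = (i, j)" by (cases p)
    have "norm (a $ i $ j) * (\<rho> ^ i * \<rho> ^ j) \<le> (M * R ^ (i + j)) * (\<rho> ^ i * \<rho> ^ j)"
      by (rule mult_right_mono[OF b]) (use \<rho> in auto)
    also have "\<dots> = M * ((R * \<rho>) ^ i * (R * \<rho>) ^ j)"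
      by (simp add: power_add power_mult_distrib mult_ac)
    also have "R * \<rho> = 1 / 2" using R by (simp add: \<rho>_def)
    finally show "(case p of (i, j) \<Rightarrow> norm (a $ i $ j) * \<rho> ^ i * \<rho> ^ j)
        \<le> M * (case p of (i, j) \<Rightarrow> (1 / 2) ^ i * (1 / 2) ^ j)"
      by (simp add: p mult.assoc)
    show "0 \<le> (case p of (i, j) \<Rightarrow> norm (a $ i $ j) * \<rho> ^ i * \<rho> ^ j)"
      using \<rho> by (simp add: p)
  qed
  with \<rho> show "convergent2 a" unfolding convergent2_def by blast
qed

lemma convergent2_const: "convergent2 (fps_const (fps_const c))"
  unfolding convergent2_iff_bound
  by (intro exI[of _ "norm c"] exI[of _ 1]) auto

lemma convergent2_add:
  assumes "convergent2 a" "convergent2 b"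
  shows "convergent2 (a + b)"
proof -
  obtain M R where R: "0 < R" and a: "\<And>i j. norm (a $ i $ j) \<le> M * R ^ (i + j)"
    using assms(1) unfolding convergent2_iff_bound by blast
  obtain N S where S: "0 < S" and b: "\<And>i j. norm (b $ i $ j) \<le> N * S ^ (i + j)"
    using assms(2) unfolding convergent2_iff_bound by blast
  have M: "M \<ge> 0" and N: "N \<ge> 0"
    using order_trans[OF norm_ge_zero a[of 0 0]] order_trans[OF norm_ge_zero b[of 0 0]] by auto
  have "norm ((a + b) $ i $ j) \<le> (M + N) * (R + S) ^ (i + j)" for i j
  proof -
    have "norm ((a + b) $ i $ j) \<le> M * R ^ (i + j) + N * S ^ (i + j)"
      using norm_triangle_mono[OF a b] by simp
    also have "\<dots> \<le> M * (R + S) ^ (i + j) + N * (R + S) ^ (i + j)"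
      using R S M N by (intro add_mono mult_left_mono power_mono) auto
    finally show ?thesis by (simp add: algebra_simps)
  qed
  with R S show ?thesis
    unfolding convergent2_iff_bound by (intro exI[of _ "M + N"] exI[of _ "R + S"]) auto
qed

lemma convergent2_uminus: "convergent2 a \<Longrightarrow> convergent2 (- a)"
  unfolding convergent2_def by simp

lemma convergent2_mult:
  assumes "convergent2 a" "convergent2 b"
  shows "convergent2 (a * b)"
proof -
  obtain M R where R: "0 < R" and a: "\<And>i j. norm (a $ i $ j) \<le> M * R ^ (i + j)"
    using assms(1) unfolding convergent2_iff_bound by blast
  obtain N S where S: "0 < S" and b: "\<And>i j. norm (b $ i $ j) \<le> N * S ^ (i + j)"
    using assms(2) unfolding convergent2_iff_bound by blast
  have M: "M \<ge> 0" and N: "N \<ge> 0"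
    using order_trans[OF norm_ge_zero a[of 0 0]] order_trans[OF norm_ge_zero b[of 0 0]] by auto
  define T where "T = R + S"
  have T: "T > 0" using R S by (simp add: T_def)
  have a': "norm (a $ i $ j) \<le> M * T ^ (i + j)" for i j
    by (rule order_trans[OF a]) (use R S M in \<open>auto simp: T_def intro!: mult_left_mono power_mono\<close>)
  have b': "norm (b $ i $ j) \<le> N * T ^ (i + j)" for i j
    by (rule order_trans[OF b]) (use R S N in \<open>auto simp: T_def intro!: mult_left_mono power_mono\<close>)
  have pow: "real (Suc n) \<le> 2 ^ n" for n
    by (metis Suc_leI less_exp of_nat_le_iff of_nat_numeral of_nat_power)
  have "norm ((a * b) $ i $ j) \<le> (M * N) * (2 * T) ^ (i + j)" for i j
  proof -
    have "(a * b) $ i $ j = (\<Sum>k=0..i. \<Sum>l=0..j. a $ k $ l * b $ (i - k) $ (j - l))"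
      by (simp add: fps_mult_nth fps_sum_nth)
    also have "norm \<dots> \<le> (\<Sum>k=0..i. \<Sum>l=0..j. M * N * T ^ (i + j))"
    proof (intro sum_norm_le)
      fix k l assume kl: "k \<in> {0..i}" "l \<in> {0..j}"
      have "norm (a $ k $ l * b $ (i - k) $ (j - l))
          \<le> (M * T ^ (k + l)) * (N * T ^ ((i - k) + (j - l)))"
        unfolding norm_mult using a' b' M T by (intro mult_mono) auto
      also have "\<dots> = M * N * T ^ ((k + l) + ((i - k) + (j - l)))"
        by (simp only: power_add mult_ac)
      also have "(k + l) + ((i - k) + (j - l)) = i + j" using kl by auto
      finally show "norm (a $ k $ l * b $ (i - k) $ (j - l)) \<le> M * N * T ^ (i + j)" .
    qed
    also have "\<dots> = (real (Suc i) * real (Suc j)) * (M * N * T ^ (i + j))"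
      by (simp add: algebra_simps)
    also have "\<dots> \<le> (2 ^ i * 2 ^ j) * (M * N * T ^ (i + j))"
      using M N T pow by (intro mult_right_mono mult_mono) auto
    also have "\<dots> = (M * N) * (2 * T) ^ (i + j)"
      by (simp add: power_add power_mult_distrib mult_ac)
    finally show ?thesis .
  qed
  with T show ?thesis
    unfolding convergent2_iff_bound by (intro exI[of _ "M * N"] exI[of _ "2 * T"]) auto
qed

typedef hgerm = "{a. convergent2 a}"
  morphisms series_of hgerm_of
  using convergent2_const[of 0] by auto

setup_lifting type_definition_hgerm

instantiation hgerm :: idom
begin

lift_definition zero_hgerm :: hgerm is 0
  using convergent2_const[of 0] by simp
lift_definition one_hgerm :: hgerm is 1
  using convergent2_const[of 1] by simp
lift_definition plus_hgerm :: "hgerm \<Rightarrow> hgerm \<Rightarrow> hgerm" is "(+)"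
  by (rule convergent2_add)
lift_definition uminus_hgerm :: "hgerm \<Rightarrow> hgerm" is uminus
  by (rule convergent2_uminus)
lift_definition minus_hgerm :: "hgerm \<Rightarrow> hgerm \<Rightarrow> hgerm" is "(-)"
  by (metis add_uminus_conv_diff convergent2_add convergent2_uminus)
lift_definition times_hgerm :: "hgerm \<Rightarrow> hgerm \<Rightarrow> hgerm" is "(*)"
  by (rule convergent2_mult)

instance
  by standard (transfer; simp add: algebra_simps)+

end

lift_definition const_germ :: "complex \<Rightarrow> hgerm" is "\<lambda>c. fps_const (fps_const c)"
  by (rule convergent2_const)

text \<open>Only the values near the origin are meaningful; where the series diverges, \<open>infsum\<close> is 0.\<close>

definition germ_eval :: "hgerm \<Rightarrow> complex \<times> complex \<Rightarrow> complex" where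
  "germ_eval f p = (\<Sum>\<^sub>\<infinity>(i, j). series_of f $ i $ j * fst p ^ i * snd p ^ j)"


section \<open>Plane curve germs and uniformizations\<close>

definition same_germ :: "(complex \<times> complex) set \<Rightarrow> (complex \<times> complex) set \<Rightarrow> bool" where
  "same_germ A B \<longleftrightarrow> (\<forall>\<^sub>F p in nhds 0. p \<in> A \<longleftrightarrow> p \<in> B)"

definition irreducible_curve :: "(complex \<times> complex) set \<Rightarrow> bool" where
  "irreducible_curve S \<longleftrightarrow> (\<exists>f. irreducible f \<and> same_germ S {p. germ_eval f p = 0})"

text \<open>
  A reduced curve germ is determined by its point set. \<open>B 1, \<dots>, B r\<close> are the distinct
  irreducible components of the reduced germ \<open>\<Union>k\<in>{1..r}. B k\<close>.
\<close>

definition reduced_curve :: "nat \<Rightarrow> (nat \<Rightarrow> (complex \<times> complex) set) \<Rightarrow> bool" where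
  "reduced_curve r B \<longleftrightarrow>
     (\<forall>k\<in>{1..r}. irreducible_curve (B k)) \<and>
     (\<forall>j\<in>{1..r}. \<forall>k\<in>{1..r}. j \<noteq> k \<longrightarrow> \<not> same_germ (B j) (B k))"

text \<open>
  The image of the germ \<open>\<gamma>\<close> is the image of every sufficiently small disc, because an injective
  \<open>\<gamma>\<close> on a fixed open disc may return to the origin near the boundary of the disc.
\<close>

definition uniformization :: "(complex \<Rightarrow> complex \<times> complex) \<Rightarrow> (complex \<times> complex) set \<Rightarrow> bool" where
  "uniformization \<gamma> S \<longleftrightarrow>
     \<gamma> 0 = 0 \<and>
     (\<exists>\<epsilon>>0. (\<lambda>t. fst (\<gamma> t)) holomorphic_on ball 0 \<epsilon> \<and> (\<lambda>t. snd (\<gamma> t)) holomorphic_on ball 0 \<epsilon> \<and>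
            inj_on \<gamma> (ball 0 \<epsilon>)) \<and>
     (\<forall>\<^sub>F \<epsilon> in at_right 0. same_germ (\<gamma> ` ball 0 \<epsilon>) S)"

definition curve_ord :: "(complex \<Rightarrow> complex \<times> complex) \<Rightarrow> hgerm \<Rightarrow> enat" where
  "curve_ord \<gamma> f =
     (if \<forall>\<^sub>F t in nhds 0. germ_eval f (\<gamma> t) = 0 then \<infinity>
      else enat (nat (zorder (\<lambda>t. germ_eval f (\<gamma> t)) 0)))"


section \<open>The filtration and its Hilbert function\<close>

text \<open>Orders are nonnegative, so a condition with negative \<open>v\<^sub>k\<close> is void, as is \<open>nat v\<^sub>k = 0\<close>.\<close>

definition Jideal :: "nat \<Rightarrow> (nat \<Rightarrow> complex \<Rightarrow> complex \<times> complex) \<Rightarrow> (nat \<Rightarrow>\<^sub>0 int) \<Rightarrow> hgerm set" where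
  "Jideal r \<gamma> v = {f. \<forall>k\<in>{1..r}. enat (nat (Poly_Mapping.lookup v k)) \<le> curve_ord (\<gamma> k) f}"

text \<open>The classes modulo \<open>J\<close> of the elements of \<open>B\<close> form a basis of the quotient by \<open>J\<close>.\<close>

definition basis_mod :: "hgerm set \<Rightarrow> hgerm set \<Rightarrow> bool" where
  "basis_mod J B \<longleftrightarrow> finite B \<and>
     (\<forall>f. \<exists>c. f - (\<Sum>b\<in>B. const_germ (c b) * b) \<in> J) \<and>
     (\<forall>c. (\<Sum>b\<in>B. const_germ (c b) * b) \<in> J \<longrightarrow> (\<forall>b\<in>B. c b = 0))"

definition quot_dim :: "hgerm set \<Rightarrow> nat" where
  "quot_dim J = (THE n. \<exists>B. basis_mod J B \<and> card B = n)"

definition hfun :: "nat \<Rightarrow> (nat \<Rightarrow> complex \<Rightarrow> complex \<times> complex) \<Rightarrow> (nat \<Rightarrow>\<^sub>0 int) \<Rightarrow> nat" where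
  "hfun r \<gamma> v = quot_dim (Jideal r \<gamma> v)"


section \<open>Formal series and the motivic Poincare series\<close>

text \<open>
  Coefficients lie in the polynomial ring over the integers in \<open>q\<close>. A monomial in the variables
  \<open>t\<^sub>k\<close> is an exponent vector \<open>v :: nat \<Rightarrow>\<^sub>0 int\<close>. Laurent polynomials are of type \<open>lpoly\<close>; formal
  series, infinite in all directions, are coefficient functions of type \<open>lseries\<close> and form a module
  over the Laurent polynomials.
\<close>

type_synonym lpoly = "(nat \<Rightarrow>\<^sub>0 int) \<Rightarrow>\<^sub>0 int poly"
type_synonym lseries = "(nat \<Rightarrow>\<^sub>0 int) \<Rightarrow> int poly"

definition qq :: "int poly" where "qq = [:0, 1:]"

definition coeff_const :: "int poly \<Rightarrow> lpoly" where
  "coeff_const c = Poly_Mapping.single 0 c"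

definition tvar :: "nat \<Rightarrow> lpoly" where
  "tvar k = Poly_Mapping.single (Poly_Mapping.single k 1) 1"

definition lmult :: "lpoly \<Rightarrow> lseries \<Rightarrow> lseries" where
  "lmult p A = (\<lambda>v. \<Sum>w\<in>Poly_Mapping.keys p. Poly_Mapping.lookup p w * A (v - w))"

definition ones :: "nat \<Rightarrow> (nat \<Rightarrow>\<^sub>0 int)" where
  "ones r = (\<Sum>k\<in>{1..r}. Poly_Mapping.single k 1)"

text \<open>The division by \<open>1 - q\<close> is exact.\<close>

definition Lg :: "nat \<Rightarrow> (nat \<Rightarrow> complex \<Rightarrow> complex \<times> complex) \<Rightarrow> lseries" where
  "Lg r \<gamma> = (\<lambda>v. if Poly_Mapping.keys v \<subseteq> {1..r}
     then (qq ^ hfun r \<gamma> v - qq ^ hfun r \<gamma> (v + ones r)) div (1 - qq) else 0)"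

definition power_series_in :: "nat \<Rightarrow> lseries \<Rightarrow> bool" where
  "power_series_in r A \<longleftrightarrow> (\<forall>v. A v \<noteq> 0 \<longrightarrow> Poly_Mapping.keys v \<subseteq> {1..r} \<and> (\<forall>k. 0 \<le> Poly_Mapping.lookup v k))"

text \<open>The quotient by \<open>t\<^sub>1 \<dots> t\<^sub>r - 1\<close> is taken among power series, where it is unique for \<open>r \<ge> 1\<close>.\<close>

definition Pg :: "nat \<Rightarrow> (nat \<Rightarrow> complex \<Rightarrow> complex \<times> complex) \<Rightarrow> lseries" where
  "Pg r \<gamma> = (THE P. power_series_in r P \<and>
     lmult ((\<Prod>k\<in>{1..r}. tvar k) - 1) P = lmult (\<Prod>k\<in>{1..r}. tvar k - 1) (Lg r \<gamma>))"

definition reduced_Pg_series :: "nat \<Rightarrow> (nat \<Rightarrow> complex \<Rightarrow> complex \<times> complex) \<Rightarrow> lseries" where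
  "reduced_Pg_series r \<gamma> = lmult (\<Prod>k\<in>{1..r}. 1 - coeff_const qq * tvar k) (Pg r \<gamma>)"

text \<open>Meaningful only if \<open>reduced_Pg_series r \<gamma>\<close> has finite support.\<close>

definition reduced_Pg :: "nat \<Rightarrow> (nat \<Rightarrow> complex \<Rightarrow> complex \<times> complex) \<Rightarrow> lpoly" where
  "reduced_Pg r \<gamma> = Abs_poly_mapping (reduced_Pg_series r \<gamma>)"

text \<open>Substitution of \<open>t\<^sub>k = 1\<close>.\<close>

definition subst_one :: "nat \<Rightarrow> lpoly \<Rightarrow> lpoly" where
  "subst_one k p =
     (\<Sum>v\<in>Poly_Mapping.keys p. Poly_Mapping.single (Poly_Mapping.update k 0 v) (Poly_Mapping.lookup p v))"

end

theory Submission
  imports Defs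
begin

text \<open>
  Write \<open>H = \<Sum>\<^sub>v q^h(v) t^v\<close> for the generating series of the Hilbert function \<open>h\<close>. The factor
  \<open>1 - t\<^sub>k\<^sup>-\<^sup>1\<close> replaces the coefficient \<open>q^h(v)\<close> by \<open>q^h(v) - q^h(v + e\<^sub>k)\<close>, and since
  \<open>\<Prod>(t\<^sub>k - 1) (1 - \<Prod>t\<^sub>k\<^sup>-\<^sup>1) = (\<Prod>t\<^sub>k - 1) \<Prod>(1 - t\<^sub>k\<^sup>-\<^sup>1)\<close>, the defining quotient gives
  \<open>(1 - q) P = \<Prod>(1 - t\<^sub>k\<^sup>-\<^sup>1) H\<close>; hence \<open>1 - q\<close> times the reduced series is
  \<open>R\<^sub>r = \<Prod>\<^sub>k (1 - q t\<^sub>k) (1 - t\<^sub>k\<^sup>-\<^sup>1) H\<close>.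
  
  Two properties of \<open>h\<close> suffice. It is constant along \<open>e\<^sub>k\<close> while \<open>v\<^sub>k < 0\<close>, and it grows by exactly one
  along \<open>e\<^sub>k\<close> as soon as \<open>v\<^sub>k \<ge> N\<^sub>k\<close>, uniformly in the other coordinates. The factor with index \<open>k\<close> kills
  \<open>H\<close> outside \<open>0 \<le> v\<^sub>k \<le> N\<^sub>k\<close>, so \<open>R\<^sub>r\<close> is a polynomial. Summing over the last exponent turns the factor
  with index \<open>r + 1\<close> into a telescoping sum, in which the contributions of the upper end cancel and only
  \<open>(1 - q) q^h(v, 0)\<close> survives; a zero last exponent imposes no condition on the new branch, so this is
  \<open>(1 - q) H\<close> for the smaller curve (\<open>subst_one_reduced_Pg\<close>). Cancelling \<open>1 - q\<close> gives
  \<open>R\<^sub>r\<close>, which is \<open>1 - q\<close> times the reduced series for \<open>r \<ge> 1\<close>. With \<open>r = 0\<close> the same computation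
  leaves \<open>q^h(0) = 1\<close>, the statement for a single branch.
  
  The geometric content is the existence of \<open>N\<^sub>k\<close> (\<open>ex_hilbert_fun\<close>): for all \<open>n \<ge> N\<^sub>k\<close> there must be a
  germ of order exactly \<open>n\<close> on the branch \<open>k\<close> that vanishes identically on all others. It is a product
  of two germs. A germ that vanishes on the other branches but not on branch \<open>k\<close> is the product of
  their equations (\<open>ex_separating_germ\<close>): if the equation of one branch vanished on another one, one
  uniformization would factor through the other, and invariance of domain would make the two branches
  equal. A germ of any sufficiently large order on the branch (\<open>ex_conductor\<close>) is found after a change
  of parameter that makes the branch \<open>\<sigma> \<mapsto> (\<sigma>^m, y(\<sigma>))\<close>: Lagrange interpolation at the
  conjugates \<open>y(\<zeta> \<sigma>)\<close>, \<open>\<zeta>^m = 1\<close>, gives a polynomial in \<open>y\<close> with coefficients holomorphic in \<open>\<sigma>^m\<close>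
  whose value on the branch is \<open>\<sigma>^n \<Prod>\<^sub>\<zeta>\<^sub>\<noteq>\<^sub>1 (y(\<sigma>) - y(\<zeta> \<sigma>))\<close>, and the product is not zero because
  the uniformization is injective.
\<close>

unbundle no vec_syntax

section \<open>Laurent polynomials acting on formal series\<close>

lemma lmult_superset:
  assumes "finite S" "Poly_Mapping.keys p \<subseteq> S"
  shows "lmult p A v = (\<Sum>w\<in>S. Poly_Mapping.lookup p w * A (v - w))"
  unfolding lmult_def
  by (rule sum.mono_neutral_left) (use assms in \<open>auto simp: in_keys_iff\<close>)

lemma lmult_single: "lmult (Poly_Mapping.single w c) A v = c * A (v - w)"
  by (subst lmult_superset[of "{w}"]) auto

lemma lmult_1 [simp]: "lmult 1 A = A"
  by (rule ext) (simp flip: single_one add: lmult_single)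

lemma lmult_add_left: "lmult (p + p') A v = lmult p A v + lmult p' A v"
proof -
  let ?S = "Poly_Mapping.keys p \<union> Poly_Mapping.keys p'"
  have "lmult (p + p') A v = (\<Sum>w\<in>?S. Poly_Mapping.lookup (p + p') w * A (v - w))"
    by (rule lmult_superset) (use keys_add[of p p'] in auto)
  also have "\<dots> = lmult p A v + lmult p' A v"
    by (simp add: lmult_superset[of ?S p] lmult_superset[of ?S p'] lookup_add distrib_right sum.distrib)
  finally show ?thesis .
qed

lemma lmult_uminus_left: "lmult (- p) A v = - lmult p A v"
  by (simp add: lmult_def sum_negf)

lemma lmult_diff_left: "lmult (p - p') A v = lmult p A v - lmult p' A v"
  using lmult_add_left[of p "- p'"] by (simp add: lmult_uminus_left)

lemma lmult_cmult: "lmult p (\<lambda>v. c * A v) v = c * lmult p A v"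
  by (simp add: lmult_def sum_distrib_left mult_ac)

text \<open>
  Laurent polynomials are sums of monomials; this reduces identities between additive operations to
  the case of two monomials, where they are shifts of exponents.
\<close>
lemma lpoly_induct [case_names single add]:
  assumes "\<And>w c. P (Poly_Mapping.single w c)" "\<And>p p'. P p \<Longrightarrow> P p' \<Longrightarrow> P (p + p')"
  shows "P (p :: lpoly)"
proof (induction p rule: update_induct)
  case const
  show ?case using assms(1)[of 0 0] by simp
next
  case (update p a b)
  have "Poly_Mapping.update a b p = p + Poly_Mapping.single a b"
    using update by (intro poly_mapping_eqI) (auto simp: lookup_update lookup_add lookup_single in_keys_iff when_def)
  then show ?case using update assms by simp
qed

text \<open>
  Formal series infinite in all directions have no product, but they form a module over the Laurent
  polynomials. All later manipulations of quotients and products are identities in the commutative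
  ring of Laurent polynomials, transported by this law.
\<close>
lemma lmult_mult: "lmult (p * p') A = lmult p (lmult p' A)"
proof (induction p rule: lpoly_induct)
  case (single w c)
  show ?case
  proof (induction p' rule: lpoly_induct)
    case (single w' c')
    show ?case
      by (rule ext) (simp add: mult_single lmult_single diff_diff_eq mult_ac add.commute)
  next
    case (add p p')
    then show ?case
      by (auto simp: fun_eq_iff distrib_left lmult_add_left lmult_single)
  qed
next
  case (add p p')
  then show ?case by (auto simp: fun_eq_iff distrib_right lmult_add_left)
qed

lemma lmult_coeff_const: "lmult (coeff_const c) A v = c * A v"
  by (simp add: coeff_const_def lmult_single)

section \<open>The numerator of the Poincare series of a Hilbert function\<close>
definition tinv :: "nat \<Rightarrow> lpoly" where
  "tinv k = Poly_Mapping.single (Poly_Mapping.single k (-1)) 1"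

abbreviation unit_vec :: "nat \<Rightarrow> (nat \<Rightarrow>\<^sub>0 int)" where
  "unit_vec k \<equiv> Poly_Mapping.single k 1"

lemma tvar_tinv: "tvar k * tinv k = 1"
  by (simp add: tvar_def tinv_def mult_single flip: single_add)

lemma single_minus_one: "Poly_Mapping.single k (-1::int) = - unit_vec k"
  by (rule poly_mapping_eqI) (auto simp: lookup_single when_def)

lemma lmult_tinv: "lmult (tinv k) A v = A (v + unit_vec k)"
  by (simp add: tinv_def lmult_single single_minus_one)

lemma lmult_tvar: "lmult (tvar k) A v = A (v - unit_vec k)"
  by (simp add: tvar_def lmult_single)

lemma prod_tvar: "(\<Prod>k\<in>{1..r}. tvar k) = Poly_Mapping.single (ones r) 1"
proof (induction r)
  case (Suc r)
  then show ?case by (simp add: tvar_def ones_def mult_single)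
qed (simp add: ones_def)

lemma prod_tinv: "(\<Prod>k\<in>{1..r}. tinv k) = Poly_Mapping.single (- ones r) 1"
proof (induction r)
  case (Suc r)
  then show ?case by (simp add: tinv_def ones_def mult_single single_minus_one)
qed (simp add: ones_def)

lemma lookup_ones: "Poly_Mapping.lookup (ones r) k = (if k \<in> {1..r} then 1 else 0)"
  by (simp add: ones_def lookup_sum lookup_single when_def sum.delta)

lemma keys_subset_iff:
  "Poly_Mapping.keys v \<subseteq> K \<longleftrightarrow> (\<forall>k. k \<notin> K \<longrightarrow> Poly_Mapping.lookup v k = 0)"
  by (auto simp: in_keys_iff)

lemma keys_subset_shift:
  assumes "k \<in> K"
  shows "Poly_Mapping.keys (v + unit_vec k) \<subseteq> K \<longleftrightarrow> Poly_Mapping.keys v \<subseteq> K"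
    "Poly_Mapping.keys (v - unit_vec k) \<subseteq> K \<longleftrightarrow> Poly_Mapping.keys v \<subseteq> K"
  using assms by (auto simp: subset_iff in_keys_iff lookup_add lookup_minus lookup_single when_def)

text \<open>
  A property that survives the action of every factor survives the product. It is used for supports:
  one factor confines the support in one coordinate, and the others do not disturb it.
\<close>
lemma lmult_prod_induct:
  assumes "P A" "\<And>k A. k \<in> K \<Longrightarrow> P A \<Longrightarrow> P (lmult (f k) A)"
  shows "P (lmult (\<Prod>k\<in>K. f k) A)"
  using assms by (induction K rule: infinite_finite_induct) (auto simp: lmult_mult)

text \<open>
  The three series are defined for an arbitrary function \<open>h\<close>, so that they also make sense for
  \<open>r = 0\<close>, where the division by \<open>t\<^sub>1 \<dots> t\<^sub>r - 1\<close> does not.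
\<close>
definition hilbert_series :: "nat \<Rightarrow> ((nat \<Rightarrow>\<^sub>0 int) \<Rightarrow> nat) \<Rightarrow> lseries" where
  "hilbert_series r h = (\<lambda>v. if Poly_Mapping.keys v \<subseteq> {1..r} then qq ^ h v else 0)"

definition numerator_series :: "nat \<Rightarrow> ((nat \<Rightarrow>\<^sub>0 int) \<Rightarrow> nat) \<Rightarrow> lseries" where
  "numerator_series r h = lmult (\<Prod>k\<in>{1..r}. 1 - tinv k) (hilbert_series r h)"

definition reduced_numerator :: "nat \<Rightarrow> ((nat \<Rightarrow>\<^sub>0 int) \<Rightarrow> nat) \<Rightarrow> lseries" where
  "reduced_numerator r h = lmult (\<Prod>k\<in>{1..r}. 1 - coeff_const qq * tvar k) (numerator_series r h)"

text \<open>
  The variable \<open>t\<^sub>k\<close> enters the reduced numerator through this one factor, because multiplication by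
  \<open>1 - t\<^sub>k\<^sup>-\<^sup>1\<close> and by \<open>1 - q t\<^sub>k\<close> commute.
\<close>
definition reduced_factor :: "nat \<Rightarrow> lpoly" where
  "reduced_factor k = (1 - coeff_const qq * tvar k) * (1 - tinv k)"

lemma lmult_one_minus_tinv: "lmult (1 - tinv k) A v = A v - A (v + unit_vec k)"
  by (simp add: lmult_diff_left lmult_tinv)

lemma lmult_reduced_factor:
  "lmult (reduced_factor k) A v = (A v - A (v + unit_vec k)) - qq * (A (v - unit_vec k) - A v)"
  by (simp add: reduced_factor_def lmult_mult lmult_diff_left lmult_coeff_const lmult_tvar lmult_tinv)

lemma reduced_numerator_eq: "reduced_numerator r h = lmult (\<Prod>k\<in>{1..r}. reduced_factor k) (hilbert_series r h)"
  by (simp add: reduced_numerator_def numerator_series_def reduced_factor_def prod.distrib flip: lmult_mult)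

lemma one_minus_qq_nz: "1 - qq \<noteq> (0 :: int poly)"
  by (simp add: qq_def one_pCons)

lemma one_minus_qq_dvd: "(1 - qq) dvd (qq ^ a - qq ^ b)"
proof -
  have *: "(1 - qq) dvd (qq ^ a - qq ^ b)" if "a \<le> b" for a b
  proof -
    have "qq ^ a - qq ^ b = qq ^ a * (1 - qq ^ (b - a))"
      using that by (simp add: right_diff_distrib flip: power_add)
    also have "1 - qq ^ (b - a) = (1 - qq) * (\<Sum>i<b - a. qq ^ i)"
      by (rule one_diff_power_eq)
    finally show ?thesis by simp
  qed
  show ?thesis
    using *[of a b] *[of b a] by (metis dvd_minus_iff minus_diff_eq nat_le_linear)
qed

lemma lmult_dvd: "(\<And>v. d dvd A v) \<Longrightarrow> d dvd lmult p A v"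
  unfolding lmult_def by (intro dvd_sum dvd_mult)

lemma hilbert_series_shift:
  assumes "k \<in> {1..r}"
  shows "hilbert_series r h (v + unit_vec k) = (if Poly_Mapping.keys v \<subseteq> {1..r} then qq ^ h (v + unit_vec k) else 0)"
    "hilbert_series r h (v - unit_vec k) = (if Poly_Mapping.keys v \<subseteq> {1..r} then qq ^ h (v - unit_vec k) else 0)"
  using assms by (simp_all add: hilbert_series_def keys_subset_shift)

text \<open>
  A single difference \<open>q^h(v) - q^h(v + e\<^sub>1)\<close> is already divisible; for \<open>r = 0\<close> no difference is
  taken, and the statement fails.
\<close>
lemma one_minus_qq_dvd_numerator_series:
  assumes "r \<ge> 1"
  shows "(1 - qq) dvd numerator_series r h v"
proof -
  have "(\<Prod>k\<in>{1..r}. 1 - tinv k) = (\<Prod>k\<in>{1..r} - {1}. 1 - tinv k) * (1 - tinv 1)"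
    using assms by (subst prod.remove[of _ 1]) auto
  then have "numerator_series r h = lmult (\<Prod>k\<in>{1..r} - {1}. 1 - tinv k) (lmult (1 - tinv 1) (hilbert_series r h))"
    by (simp add: numerator_series_def lmult_mult)
  moreover have "(1 - qq) dvd lmult (1 - tinv 1) (hilbert_series r h) v" for v
  proof -
    have "1 \<in> {1..r}" using assms by simp
    from hilbert_series_shift(1)[OF this, of h v] show ?thesis
      by (auto simp only: lmult_one_minus_tinv hilbert_series_def one_minus_qq_dvd diff_self dvd_0_right split: if_splits)
  qed
  ultimately show ?thesis by (simp only: lmult_dvd)
qed

text \<open>
  The two properties of the Hilbert function of a curve on which the combinatorics rests. The bound
  \<open>N k\<close> must be uniform in the coordinates other than \<open>k\<close>: this is what makes the reduced series a
  polynomial rather than only a power series.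
\<close>
locale hilbert_fun =
  fixes r :: nat and h :: "(nat \<Rightarrow>\<^sub>0 int) \<Rightarrow> nat" and N :: "nat \<Rightarrow> nat"
  assumes h_neg: "\<And>k v. k \<in> {1..r} \<Longrightarrow> Poly_Mapping.lookup v k < 0 \<Longrightarrow> h (v + unit_vec k) = h v"
    and h_large: "\<And>k v. k \<in> {1..r} \<Longrightarrow> int (N k) \<le> Poly_Mapping.lookup v k \<Longrightarrow> h (v + unit_vec k) = Suc (h v)"
begin

lemma numerator_series_support:
  assumes "numerator_series r h v \<noteq> 0"
  shows "Poly_Mapping.keys v \<subseteq> {1..r}" "0 \<le> Poly_Mapping.lookup v k"
proof -
  have "\<forall>v. numerator_series r h v \<noteq> 0 \<longrightarrow> Poly_Mapping.keys v \<subseteq> {1..r}"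
    unfolding numerator_series_def
  proof (rule lmult_prod_induct[where P = "\<lambda>A. \<forall>v. A v \<noteq> 0 \<longrightarrow> Poly_Mapping.keys v \<subseteq> {1..r}"], goal_cases)
    case (2 j A)
    then show ?case
      using keys_subset_shift[OF 2(1)] by (metis diff_self lmult_one_minus_tinv)
  qed (simp add: hilbert_series_def)
  with assms show keys: "Poly_Mapping.keys v \<subseteq> {1..r}" by blast
  show "0 \<le> Poly_Mapping.lookup v k"
  proof (cases "k \<in> {1..r}")
    case True
    have "(\<Prod>k\<in>{1..r}. 1 - tinv k) = (\<Prod>j\<in>{1..r} - {k}. 1 - tinv j) * (1 - tinv k)"
      using True by (subst prod.remove[of _ k]) auto
    then have eq: "numerator_series r h = lmult (\<Prod>j\<in>{1..r} - {k}. 1 - tinv j) (lmult (1 - tinv k) (hilbert_series r h))"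
      by (simp add: numerator_series_def lmult_mult)
    have "\<forall>v. numerator_series r h v \<noteq> 0 \<longrightarrow> 0 \<le> Poly_Mapping.lookup v k"
      unfolding eq
    proof (rule lmult_prod_induct[where P = "\<lambda>A. \<forall>v. A v \<noteq> 0 \<longrightarrow> 0 \<le> Poly_Mapping.lookup v k"], goal_cases)
      case 1
      show ?case
      proof (intro allI impI, rule ccontr)
        fix v assume *: "lmult (1 - tinv k) (hilbert_series r h) v \<noteq> 0" and "\<not> 0 \<le> Poly_Mapping.lookup v k"
        then have "h (v + unit_vec k) = h v" using h_neg[OF True] by simp
        with * show False
          by (simp only: lmult_one_minus_tinv hilbert_series_shift[OF True]) (simp add: hilbert_series_def split: if_splits)
      qed
    next
      case (2 j A)
      show ?case
      proof (intro allI impI)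
        fix v assume "lmult (1 - tinv j) A v \<noteq> 0"
        then have "A v \<noteq> 0 \<or> A (v + unit_vec j) \<noteq> 0"
          by (auto simp: lmult_one_minus_tinv)
        then obtain w where "A w \<noteq> 0" "Poly_Mapping.lookup w k = Poly_Mapping.lookup v k"
          using 2(1) by (auto simp: lookup_add lookup_single_not_eq)
        with 2(2) show "0 \<le> Poly_Mapping.lookup v k"
          by metis
      qed
    qed
    with assms show ?thesis by blast
  next
    case False
    then show ?thesis using keys by (simp add: keys_subset_iff)
  qed
qed

text \<open>
  Below the range all values of \<open>h\<close> involved agree. Above it, \<open>h\<close> increases by one twice in a row, so the
  difference \<open>q^h(v) - q^h(v + e\<^sub>k)\<close> is \<open>q\<close> times the previous one, which is what \<open>1 - q t\<^sub>k\<close> cancels.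
\<close>
lemma lmult_reduced_factor_hilbert_series_support:
  assumes k: "k \<in> {1..r}" and nz: "lmult (reduced_factor k) (hilbert_series r h) v \<noteq> 0"
  shows "Poly_Mapping.lookup v k \<in> {0..int (N k)}"
proof (rule ccontr)
  assume "Poly_Mapping.lookup v k \<notin> {0..int (N k)}"
  then consider "Poly_Mapping.lookup v k < 0" | "Poly_Mapping.lookup v k > int (N k)" by force
  then have "lmult (reduced_factor k) (hilbert_series r h) v = 0"
  proof cases
    case 1
    then have "h (v + unit_vec k) = h v" "h v = h (v - unit_vec k)"
      using h_neg[OF k, of v] h_neg[OF k, of "v - unit_vec k"] by (auto simp: lookup_minus)
    then show ?thesis
      using k by (simp add: lmult_reduced_factor hilbert_series_shift del: One_nat_def) (simp add: hilbert_series_def)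
  next
    case 2
    then have "h (v + unit_vec k) = Suc (h v)" "h v = Suc (h (v - unit_vec k))"
      using h_large[OF k, of v] h_large[OF k, of "v - unit_vec k"] by (auto simp: lookup_minus)
    then show ?thesis
      using k by (simp add: lmult_reduced_factor hilbert_series_shift del: One_nat_def) (simp add: hilbert_series_def algebra_simps)
  qed
  with nz show False by simp
qed

lemma reduced_numerator_support:
  assumes "reduced_numerator r h v \<noteq> 0"
  shows "Poly_Mapping.keys v \<subseteq> {1..r}" "k \<in> {1..r} \<Longrightarrow> Poly_Mapping.lookup v k \<in> {0..int (N k)}"
proof -
  have "\<forall>v. reduced_numerator r h v \<noteq> 0 \<longrightarrow> Poly_Mapping.keys v \<subseteq> {1..r}"
    unfolding reduced_numerator_eq
  proof (rule lmult_prod_induct[where P = "\<lambda>A. \<forall>v. A v \<noteq> 0 \<longrightarrow> Poly_Mapping.keys v \<subseteq> {1..r}"], goal_cases)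
    case (2 j A)
    show ?case
    proof (intro allI impI)
      fix v assume "lmult (reduced_factor j) A v \<noteq> 0"
      then have "A v \<noteq> 0 \<or> A (v + unit_vec j) \<noteq> 0 \<or> A (v - unit_vec j) \<noteq> 0"
        by (auto simp: lmult_reduced_factor)
      with 2(2) show "Poly_Mapping.keys v \<subseteq> {1..r}"
        using keys_subset_shift[OF 2(1)] by blast
    qed
  qed (simp add: hilbert_series_def)
  with assms show "Poly_Mapping.keys v \<subseteq> {1..r}" by blast
  assume k: "k \<in> {1..r}"
  have "(\<Prod>k\<in>{1..r}. reduced_factor k) = (\<Prod>j\<in>{1..r} - {k}. reduced_factor j) * reduced_factor k"
    using k by (subst prod.remove[of _ k]) auto
  then have eq: "reduced_numerator r h = lmult (\<Prod>j\<in>{1..r} - {k}. reduced_factor j) (lmult (reduced_factor k) (hilbert_series r h))"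
    by (simp add: reduced_numerator_eq lmult_mult)
  have "\<forall>v. reduced_numerator r h v \<noteq> 0 \<longrightarrow> Poly_Mapping.lookup v k \<in> {0..int (N k)}"
    unfolding eq
  proof (rule lmult_prod_induct[where P = "\<lambda>A. \<forall>v. A v \<noteq> 0 \<longrightarrow> Poly_Mapping.lookup v k \<in> {0..int (N k)}"], goal_cases)
    case 1
    show ?case using lmult_reduced_factor_hilbert_series_support[OF k] by blast
  next
    case (2 j A)
    then have jk: "j \<noteq> k" by auto
    show ?case
    proof (intro allI impI)
      fix v assume "lmult (reduced_factor j) A v \<noteq> 0"
      then have "A v \<noteq> 0 \<or> A (v + unit_vec j) \<noteq> 0 \<or> A (v - unit_vec j) \<noteq> 0"
        by (auto simp: lmult_reduced_factor)
      then obtain w where "A w \<noteq> 0" "Poly_Mapping.lookup w k = Poly_Mapping.lookup v k"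
        using jk by (auto simp: lookup_add lookup_minus lookup_single_not_eq)
      with 2(2) show "Poly_Mapping.lookup v k \<in> {0..int (N k)}"
        by metis
    qed
  qed
  with assms show "Poly_Mapping.lookup v k \<in> {0..int (N k)}" by blast
qed

lemma finite_reduced_numerator_support: "finite {v. reduced_numerator r h v \<noteq> 0}"
proof -
  let ?F = "\<lambda>v. restrict (Poly_Mapping.lookup v) {1..r}"
  have "finite (Pi\<^sub>E {1..r} (\<lambda>k. {0..int (N k)}))"
    by (rule finite_PiE) auto
  moreover have "?F ` {v. reduced_numerator r h v \<noteq> 0} \<subseteq> Pi\<^sub>E {1..r} (\<lambda>k. {0..int (N k)})"
    using reduced_numerator_support(2) by (auto simp: image_subset_iff simp del: atLeastAtMost_iff)
  moreover have "inj_on ?F {v. reduced_numerator r h v \<noteq> 0}"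
  proof (rule inj_onI, rule poly_mapping_eqI)
    fix v w k assume v: "v \<in> {v. reduced_numerator r h v \<noteq> 0}" and w: "w \<in> {v. reduced_numerator r h v \<noteq> 0}" and eq: "?F v = ?F w"
    show "Poly_Mapping.lookup v k = Poly_Mapping.lookup w k"
    proof (cases "k \<in> {1..r}")
      case True then show ?thesis using fun_cong[OF eq, of k] by simp
    next
      case False
      then have "k \<notin> Poly_Mapping.keys v" "k \<notin> Poly_Mapping.keys w"
        using reduced_numerator_support(1)[of v] reduced_numerator_support(1)[of w] v w by blast+
      then show ?thesis by (simp add: in_keys_iff)
    qed
  qed
  ultimately show ?thesis by (meson finite_subset inj_on_finite)
qed

end

section \<open>Summation over the last exponent\<close>
lemma sum_reduced_differences:
  fixes a :: "int \<Rightarrow> int poly"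
  shows "(\<Sum>n\<le>M. (a (int n) - a (int n + 1)) - q * (a (int n - 1) - a (int n)))
    = a 0 - a (int M + 1) - q * (a (-1) - a (int M))"
  by (induction M) (simp_all add: algebra_simps)

text \<open>
  Substitution of \<open>t\<^sub>k = 1\<close> for series whose exponents of \<open>t\<^sub>k\<close> lie in \<open>{0..M}\<close>. Truncating at a
  fixed \<open>M\<close> makes it defined for every series and makes it commute with all operators that do not
  involve \<open>t\<^sub>k\<close>, without any support condition.
\<close>
definition sum_out :: "nat \<Rightarrow> nat \<Rightarrow> lseries \<Rightarrow> lseries" where
  "sum_out k M A w =
    (if Poly_Mapping.lookup w k = 0 then \<Sum>n\<le>M. A (w + Poly_Mapping.single k (int n)) else 0)"

lemma sum_out_lmult_reduced_factor:
  assumes "j \<noteq> k"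
  shows "sum_out k M (lmult (reduced_factor j) A) = lmult (reduced_factor j) (sum_out k M A)"
proof
  fix w
  have sh: "w + unit_vec j + Poly_Mapping.single k i = w + Poly_Mapping.single k i + unit_vec j"
    "w - unit_vec j + Poly_Mapping.single k i = w + Poly_Mapping.single k i - unit_vec j" for i
    by (simp_all add: algebra_simps)
  show "sum_out k M (lmult (reduced_factor j) A) w = lmult (reduced_factor j) (sum_out k M A) w"
    using assms
    by (simp add: sum_out_def lmult_reduced_factor sh lookup_add lookup_minus lookup_single_not_eq sum_subtractf
        sum_distrib_left right_diff_distrib)
qed

lemma sum_out_lmult_prod_reduced_factor:
  assumes "k \<notin> K"
  shows "sum_out k M (lmult (\<Prod>j\<in>K. reduced_factor j) A) = lmult (\<Prod>j\<in>K. reduced_factor j) (sum_out k M A)"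
  using assms
  by (induction K rule: infinite_finite_induct) (auto simp: lmult_mult sum_out_lmult_reduced_factor)

text \<open>
  The heart of the matter: the sum telescopes to a contribution of the exponent \<open>0\<close> and one of the last
  exponent, and the latter vanishes since \<open>h'\<close> has already begun to grow by one there.
\<close>
lemma sum_out_lmult_reduced_factor_hilbert_series:
  assumes "hilbert_fun (Suc r) h' N"
    and restr: "\<And>v. Poly_Mapping.keys v \<subseteq> {1..r} \<Longrightarrow> h' v = h v"
  shows "sum_out (Suc r) (N (Suc r)) (lmult (reduced_factor (Suc r)) (hilbert_series (Suc r) h')) = (\<lambda>w. (1 - qq) * hilbert_series r h w)"
proof
  fix w :: "nat \<Rightarrow>\<^sub>0 int"
  interpret hilbert_fun "Suc r" h' N by fact
  let ?k = "Suc r" and ?M = "N (Suc r)"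
  define e where "e = (\<lambda>i::int. w + Poly_Mapping.single ?k i)"
  define a where "a = (\<lambda>i. hilbert_series ?k h' (e i))"
  have e: "e i + unit_vec ?k = e (i + 1)" "e i - unit_vec ?k = e (i - 1)" for i
    by (rule poly_mapping_eqI, simp add: e_def lookup_add lookup_minus lookup_single when_def)+
  have keys: "Poly_Mapping.keys (e i) \<subseteq> {1..?k} \<longleftrightarrow> Poly_Mapping.keys w \<subseteq> {1..?k}" for i
    unfolding keys_subset_iff by (auto simp: e_def lookup_add lookup_single when_def)
  show "sum_out ?k ?M (lmult (reduced_factor ?k) (hilbert_series ?k h')) w = (1 - qq) * hilbert_series r h w"
  proof (cases "Poly_Mapping.lookup w ?k = 0")
    case True
    have w0: "e 0 = w" by (simp add: e_def)
    have lk: "Poly_Mapping.lookup (e i) ?k = i" for i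
      using True by (simp add: e_def lookup_add)
    have "h' (e (-1)) = h' (e 0)"
      using h_neg[of ?k "e (-1)"] by (simp add: e lk)
    then have am1: "a (-1) = a 0" by (simp only: a_def hilbert_series_def keys)
    have "h' (e (int ?M + 1)) = Suc (h' (e (int ?M)))"
      using h_large[of ?k "e (int ?M)"] by (simp add: e lk)
    then have aM: "a (int ?M + 1) = qq * a (int ?M)"
      by (simp only: a_def hilbert_series_def keys power_Suc if_distrib[of "(*) qq"] mult_zero_right)
    have "Poly_Mapping.keys w \<subseteq> {1..?k} \<longleftrightarrow> Poly_Mapping.keys w \<subseteq> {1..r}"
      using True unfolding keys_subset_iff by (metis atLeastAtMost_iff le_Suc_eq)
    then have a0: "a 0 = hilbert_series r h w"
      using restr by (simp add: a_def w0 hilbert_series_def)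
    have "sum_out ?k ?M (lmult (reduced_factor ?k) (hilbert_series ?k h')) w
        = (\<Sum>n\<le>?M. lmult (reduced_factor ?k) (hilbert_series ?k h') (e (int n)))"
      using True by (simp add: sum_out_def e_def)
    also have "\<dots> = (\<Sum>n\<le>?M. (a (int n) - a (int n + 1)) - qq * (a (int n - 1) - a (int n)))"
      by (simp add: lmult_reduced_factor e a_def)
    also have "\<dots> = (1 - qq) * a 0"
      unfolding sum_reduced_differences am1 aM by (simp add: algebra_simps)
    finally show ?thesis by (simp add: a0)
  next
    case False
    then have "\<not> Poly_Mapping.keys w \<subseteq> {1..r}" by (auto simp: subset_iff in_keys_iff)
    with False show ?thesis by (simp add: sum_out_def hilbert_series_def)
  qed
qed

lemma sum_out_reduced_numerator:
  assumes "hilbert_fun (Suc r) h' N"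
    and "\<And>v. Poly_Mapping.keys v \<subseteq> {1..r} \<Longrightarrow> h' v = h v"
  shows "sum_out (Suc r) (N (Suc r)) (reduced_numerator (Suc r) h') = (\<lambda>w. (1 - qq) * reduced_numerator r h w)"
proof -
  have "reduced_numerator (Suc r) h' = lmult (\<Prod>k\<in>{1..r}. reduced_factor k) (lmult (reduced_factor (Suc r)) (hilbert_series (Suc r) h'))"
    by (simp add: reduced_numerator_eq mult.commute flip: lmult_mult)
  then have "sum_out (Suc r) (N (Suc r)) (reduced_numerator (Suc r) h')
      = lmult (\<Prod>k\<in>{1..r}. reduced_factor k) (\<lambda>w. (1 - qq) * hilbert_series r h w)"
    using sum_out_lmult_prod_reduced_factor[of "Suc r" "{1..r}"] sum_out_lmult_reduced_factor_hilbert_series[OF assms] by simp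
  then show ?thesis
    by (simp only: lmult_cmult reduced_numerator_eq fun_eq_iff) simp
qed

section \<open>The Poincare series as a quotient\<close>
lemma Lg_conv: "(1 - qq) * Lg r \<gamma> v = lmult (1 - (\<Prod>k\<in>{1..r}. tinv k)) (hilbert_series r (hfun r \<gamma>)) v"
proof -
  have "Poly_Mapping.keys (v + ones r) \<subseteq> {1..r} \<longleftrightarrow> Poly_Mapping.keys v \<subseteq> {1..r}"
    unfolding keys_subset_iff by (simp add: lookup_add lookup_ones del: atLeastAtMost_iff)
  moreover have "(1 - qq) dvd (qq ^ hfun r \<gamma> v - qq ^ hfun r \<gamma> (v + ones r))"
    by (rule one_minus_qq_dvd)
  ultimately show ?thesis
    by (simp add: Lg_def lmult_diff_left prod_tinv lmult_single hilbert_series_def del: One_nat_def)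
qed

text \<open>
  Uniqueness of the quotient by \<open>t\<^sub>1 \<dots> t\<^sub>r - 1\<close>: a nonzero coefficient of a solution of the homogeneous
  equation would propagate along the diagonal to negative exponents.
\<close>
lemma power_series_shift_eq_0:
  assumes "power_series_in r D" "r \<ge> 1" and shift: "\<And>v. D (v - ones r) = D v"
  shows "D v = 0"
proof (rule ccontr)
  assume nz: "D v \<noteq> 0"
  have "\<forall>v. D v \<noteq> 0 \<longrightarrow> int n \<le> Poly_Mapping.lookup v 1" for n
  proof (induction n)
    case 0
    then show ?case using assms(1) by (simp add: power_series_in_def)
  next
    case (Suc n)
    show ?case
    proof (intro allI impI)
      fix v assume "D v \<noteq> 0"
      then have "D (v - ones r) \<noteq> 0" by (simp add: shift)
      then have "int n \<le> Poly_Mapping.lookup (v - ones r) 1" using Suc by blast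
      then show "int (Suc n) \<le> Poly_Mapping.lookup v 1"
        using assms(2) by (simp add: lookup_minus lookup_ones)
    qed
  qed
  from this[of "Suc (nat (Poly_Mapping.lookup v 1))"] nz
  have "int (Suc (nat (Poly_Mapping.lookup v 1))) \<le> Poly_Mapping.lookup v 1" by blast
  then show False by linarith
qed

text \<open>
  Both sides of the defining equation become the action of the same Laurent polynomial on
  \<open>hilbert_series\<close> after multiplication by \<open>1 - q\<close>, by the identity
  \<open>\<Prod>(t\<^sub>k - 1) (1 - \<Prod>t\<^sub>k\<^sup>-\<^sup>1) = (\<Prod>t\<^sub>k - 1) \<Prod>(1 - t\<^sub>k\<^sup>-\<^sup>1)\<close>.
\<close>
lemma Pg_conv:
  assumes "r \<ge> 1" "hilbert_fun r (hfun r \<gamma>) N"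
  shows "(1 - qq) * Pg r \<gamma> v = numerator_series r (hfun r \<gamma>) v"
proof -
  interpret hilbert_fun r "hfun r \<gamma>" N by fact
  let ?h = "hfun r \<gamma>"
  let ?X = "(\<Prod>k\<in>{1..r}. tvar k) - 1 :: lpoly" and ?Y = "\<Prod>k\<in>{1..r}. tvar k - 1 :: lpoly"
  define P where "P = (\<lambda>v. numerator_series r ?h v div (1 - qq))"
  have P: "(1 - qq) * P v = numerator_series r ?h v" for v
    using one_minus_qq_dvd_numerator_series[OF assms(1)] by (simp add: P_def)
  have ser: "power_series_in r P"
    using numerator_series_support P unfolding power_series_in_def by (metis mult_zero_right one_minus_qq_nz mult_eq_0_iff)
  have "?Y = (\<Prod>k\<in>{1..r}. tvar k * (1 - tinv k))"
    by (simp add: right_diff_distrib tvar_tinv)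
  then have Y: "?Y = (\<Prod>k\<in>{1..r}. tvar k) * (\<Prod>k\<in>{1..r}. 1 - tinv k)"
    by (simp only: prod.distrib)
  have "(\<Prod>k\<in>{1..r}. tvar k) * (\<Prod>k\<in>{1..r}. tinv k) = 1"
    by (simp only: tvar_tinv prod.neutral_const flip: prod.distrib)
  then have "?Y * (1 - (\<Prod>k\<in>{1..r}. tinv k)) = ?X * (\<Prod>k\<in>{1..r}. 1 - tinv k)"
    unfolding Y by algebra
  then have "(1 - qq) * lmult ?X P w = (1 - qq) * lmult ?Y (Lg r \<gamma>) w" for w
    by (simp only: P Lg_conv numerator_series_def flip: lmult_cmult lmult_mult)
  then have eq: "lmult ?X P = lmult ?Y (Lg r \<gamma>)"
    using one_minus_qq_nz by (simp add: fun_eq_iff)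
  have "Pg r \<gamma> = P"
    unfolding Pg_def
  proof (rule the_equality, intro conjI)
    fix P' assume P': "power_series_in r P' \<and> lmult ?X P' = lmult ?Y (Lg r \<gamma>)"
    define D where "D = (\<lambda>v. P' v - P v)"
    have "D v = 0" for v
    proof (rule power_series_shift_eq_0[of r])
      show "power_series_in r D"
        using P' ser unfolding power_series_in_def D_def by (metis diff_0_right)
      fix v
      have "lmult ?X P' v = lmult ?X P v" using P' eq by simp
      then show "D (v - ones r) = D v"
        by (simp add: lmult_diff_left prod_tvar lmult_single D_def algebra_simps del: One_nat_def)
    qed (use assms in simp)
    then show "P' = P" by (simp add: D_def fun_eq_iff)
  qed (fact ser eq)+
  with P show ?thesis by simp
qed

lemma reduced_Pg_series_conv:
  assumes "r \<ge> 1" "hilbert_fun r (hfun r \<gamma>) N"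
  shows "(1 - qq) * reduced_Pg_series r \<gamma> v = reduced_numerator r (hfun r \<gamma>) v"
  by (simp only: reduced_Pg_series_def reduced_numerator_def Pg_conv[OF assms] flip: lmult_cmult)

lemma reduced_Pg_series_support:
  assumes "r \<ge> 1" "hilbert_fun r (hfun r \<gamma>) N"
  shows "reduced_Pg_series r \<gamma> v \<noteq> 0 \<longleftrightarrow> reduced_numerator r (hfun r \<gamma>) v \<noteq> 0"
  using one_minus_qq_nz by (simp flip: reduced_Pg_series_conv[OF assms])

lemma finite_reduced_Pg_series:
  assumes "r \<ge> 1" "hilbert_fun r (hfun r \<gamma>) N"
  shows "finite {v. reduced_Pg_series r \<gamma> v \<noteq> 0}"
  using hilbert_fun.finite_reduced_numerator_support[OF assms(2)]
  by (simp add: reduced_Pg_series_support[OF assms])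

lemma lookup_reduced_Pg:
  assumes "r \<ge> 1" "hilbert_fun r (hfun r \<gamma>) N"
  shows "Poly_Mapping.lookup (reduced_Pg r \<gamma>) = reduced_Pg_series r \<gamma>"
  using finite_reduced_Pg_series[OF assms] by (simp add: reduced_Pg_def)

lemma lookup_subst_one:
  assumes "\<And>v. v \<in> Poly_Mapping.keys p \<Longrightarrow> Poly_Mapping.lookup v k \<in> {0..int M}"
  shows "Poly_Mapping.lookup (subst_one k p) w = sum_out k M (Poly_Mapping.lookup p) w"
proof -
  let ?e = "\<lambda>n. w + Poly_Mapping.single k (int n)"
  let ?K = "{v \<in> Poly_Mapping.keys p. Poly_Mapping.update k 0 v = w}"
  have "Poly_Mapping.lookup (subst_one k p) w = (\<Sum>v\<in>?K. Poly_Mapping.lookup p v)"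
    by (simp add: subst_one_def lookup_sum lookup_single when_def sum.inter_filter)
  also have "\<dots> = sum_out k M (Poly_Mapping.lookup p) w"
  proof (cases "Poly_Mapping.lookup w k = 0")
    case True
    have inj: "inj_on ?e {..M}"
      by (rule inj_onI) (metis add_left_cancel lookup_single_eq of_nat_eq_iff)
    have upd: "Poly_Mapping.update k 0 (?e n) = w" for n
      using True by (intro poly_mapping_eqI) (auto simp: lookup_update lookup_add lookup_single)
    have "?K \<subseteq> ?e ` {..M}"
    proof
      fix v assume v: "v \<in> ?K"
      then have "v = ?e (nat (Poly_Mapping.lookup v k))"
        using assms[of v] by (intro poly_mapping_eqI) (auto simp: lookup_update lookup_add lookup_single)
      moreover have "nat (Poly_Mapping.lookup v k) \<in> {..M}" using assms[of v] v by auto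
      ultimately show "v \<in> ?e ` {..M}" by (rule image_eqI)
    qed
    then have "(\<Sum>v\<in>?K. Poly_Mapping.lookup p v) = (\<Sum>v\<in>?e ` {..M}. Poly_Mapping.lookup p v)"
      by (intro sum.mono_neutral_left) (auto simp: upd in_keys_iff)
    also have "\<dots> = sum_out k M (Poly_Mapping.lookup p) w"
      using True by (simp add: sum_out_def sum.reindex[OF inj])
    finally show ?thesis .
  next
    case False
    then have "?K = {}" by (auto simp: lookup_update)
    with False show ?thesis by (simp only: sum_out_def sum.empty if_False)
  qed
  finally show ?thesis .
qed

text \<open>
  This form, before the result is rewritten by the reduced series of the smaller curve, covers
  \<open>r = 0\<close> as well, where no such series exists.
\<close>
lemma lookup_subst_one_reduced_Pg:
  assumes N: "hilbert_fun (Suc r) (hfun (Suc r) \<gamma>') N"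
    and "\<And>v. Poly_Mapping.keys v \<subseteq> {1..r} \<Longrightarrow> hfun (Suc r) \<gamma>' v = h v"
  shows "Poly_Mapping.lookup (subst_one (Suc r) (reduced_Pg (Suc r) \<gamma>')) = reduced_numerator r h"
proof
  fix w
  let ?p = "reduced_Pg (Suc r) \<gamma>'"
  have p: "Poly_Mapping.lookup ?p = reduced_Pg_series (Suc r) \<gamma>'"
    using lookup_reduced_Pg[OF _ N] by simp
  have supp: "Poly_Mapping.lookup v (Suc r) \<in> {0..int (N (Suc r))}" if "v \<in> Poly_Mapping.keys ?p" for v
  proof (rule hilbert_fun.reduced_numerator_support(2)[OF N])
    show "reduced_numerator (Suc r) (hfun (Suc r) \<gamma>') v \<noteq> 0"
      using that reduced_Pg_series_support[OF _ N] by (simp add: in_keys_iff p)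
  qed simp
  have "(1 - qq) * Poly_Mapping.lookup (subst_one (Suc r) ?p) w
      = (1 - qq) * sum_out (Suc r) (N (Suc r)) (reduced_Pg_series (Suc r) \<gamma>') w"
    by (simp only: lookup_subst_one[OF supp] p)
  also have "\<dots> = sum_out (Suc r) (N (Suc r)) (\<lambda>v. (1 - qq) * reduced_Pg_series (Suc r) \<gamma>' v) w"
    by (simp add: sum_out_def sum_distrib_left)
  also have "\<dots> = (1 - qq) * reduced_numerator r h w"
    using sum_out_reduced_numerator[OF assms] reduced_Pg_series_conv[OF _ N] by simp
  finally show "Poly_Mapping.lookup (subst_one (Suc r) ?p) w = reduced_numerator r h w"
    using one_minus_qq_nz by simp
qed

lemma subst_one_reduced_Pg:
  assumes "r \<ge> 1" "hilbert_fun r (hfun r \<gamma>) N" "hilbert_fun (Suc r) (hfun (Suc r) \<gamma>') N'"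
    and "\<And>v. Poly_Mapping.keys v \<subseteq> {1..r} \<Longrightarrow> hfun (Suc r) \<gamma>' v = hfun r \<gamma> v"
  shows "subst_one (Suc r) (reduced_Pg (Suc r) \<gamma>') = coeff_const (1 - qq) * reduced_Pg r \<gamma>"
proof (rule poly_mapping_eqI)
  fix w
  have "Poly_Mapping.lookup (coeff_const c * p) w = c * Poly_Mapping.lookup p w" for c p
    by (induction p rule: lpoly_induct)
      (auto simp: coeff_const_def mult_single lookup_single lookup_add distrib_left when_def)
  then show "Poly_Mapping.lookup (subst_one (Suc r) (reduced_Pg (Suc r) \<gamma>')) w
      = Poly_Mapping.lookup (coeff_const (1 - qq) * reduced_Pg r \<gamma>) w"
    by (simp only: lookup_subst_one_reduced_Pg[OF assms(3,4)] lookup_reduced_Pg[OF assms(1,2)]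
        reduced_Pg_series_conv[OF assms(1,2)])
qed

lemma subst_one_reduced_Pg_1:
  assumes "hilbert_fun 1 (hfun 1 \<gamma>) N" "hfun 1 \<gamma> 0 = 0"
  shows "subst_one 1 (reduced_Pg 1 \<gamma>) = 1"
proof (rule poly_mapping_eqI)
  fix w
  have "Poly_Mapping.lookup (subst_one (Suc 0) (reduced_Pg (Suc 0) \<gamma>)) = reduced_numerator 0 (hfun 1 \<gamma>)"
    by (rule lookup_subst_one_reduced_Pg) (use assms in auto)
  then show "Poly_Mapping.lookup (subst_one 1 (reduced_Pg 1 \<gamma>)) w = Poly_Mapping.lookup 1 w"
    using assms(2) by (simp add: reduced_numerator_eq hilbert_series_def lookup_one)
qed

section \<open>Dimensions of quotients of the local ring\<close>
lemma const_germ_simps: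
  "const_germ 0 = 0" "const_germ 1 = 1"
  "const_germ (a + b) = const_germ a + const_germ b"
  "const_germ (a * b) = const_germ a * const_germ b"
  by (transfer, simp)+

interpretation germs: vector_space "\<lambda>c f. const_germ c * f"
  by standard (simp_all add: const_germ_simps algebra_simps)

text \<open>
  The dimension of a quotient is well defined without forming the quotient: reduction to normal form
  with respect to \<open>B'\<close> maps \<open>B\<close> injectively onto an independent subset of the span of \<open>B'\<close>.
\<close>
lemma basis_mod_card_le:
  assumes J: "germs.subspace J" and B: "basis_mod J B" and B': "basis_mod J B'"
  shows "card B \<le> card B'"
proof -
  have fin: "finite B" "finite B'" using B B' by (auto simp: basis_mod_def)
  obtain c where c: "\<And>f. f - (\<Sum>b\<in>B'. const_germ (c f b) * b) \<in> J"
    using B' unfolding basis_mod_def by metis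
  define \<rho> where "\<rho> f = (\<Sum>b\<in>B'. const_germ (c f b) * b)" for f
  have ind: "d b = 0" if "(\<Sum>b\<in>B. const_germ (d b) * \<rho> b) = 0" "b \<in> B" for d b
  proof -
    have "(\<Sum>b\<in>B. const_germ (d b) * (b - \<rho> b)) \<in> J"
      by (intro germs.subspace_sum[OF J] germs.subspace_scale[OF J]) (use c in \<open>auto simp: \<rho>_def\<close>)
    then have "(\<Sum>b\<in>B. const_germ (d b) * b) \<in> J"
      using that(1) by (simp add: right_diff_distrib sum_subtractf)
    with B that(2) show ?thesis unfolding basis_mod_def by blast
  qed
  have inj: "inj_on \<rho> B"
  proof (rule inj_onI, rule ccontr)
    fix x y assume xy: "x \<in> B" "y \<in> B" "\<rho> x = \<rho> y" "x \<noteq> y"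
    \<comment> \<open>Equal normal forms would make \<open>x - y\<close> a relation modulo \<open>J\<close>.\<close>
    let ?d = "\<lambda>b. if b = x then 1 else if b = y then - 1 else 0 :: complex"
    have "(\<Sum>b\<in>B. const_germ (?d b) * \<rho> b) = (\<Sum>b\<in>{x, y}. const_germ (?d b) * \<rho> b)"
      using fin xy by (intro sum.mono_neutral_right) (auto simp: const_germ_simps)
    also have "\<dots> = const_germ (1 + (- 1)) * \<rho> x"
      using xy by (simp only: const_germ_simps) (simp add: algebra_simps)
    finally show False using ind[of ?d x] xy by (simp add: const_germ_simps)
  qed
  have "germs.independent (\<rho> ` B)"
  proof (rule germs.independent_if_scalars_zero)
    fix d x assume "(\<Sum>x\<in>\<rho> ` B. const_germ (d x) * x) = 0" "x \<in> \<rho> ` B"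
    then show "d x = 0" using ind[of "d \<circ> \<rho>"] by (auto simp: sum.reindex[OF inj])
  qed (use fin in simp)
  moreover have "\<rho> ` B \<subseteq> germs.span B'"
  proof
    fix g assume "g \<in> \<rho> ` B"
    then obtain b where "g = (\<Sum>b'\<in>B'. const_germ (c b b') * b')" by (auto simp: \<rho>_def)
    then show "g \<in> germs.span B'"
      by (simp only:) (rule germs.span_sum, rule germs.span_scale, rule germs.span_base)
  qed
  ultimately have "card (\<rho> ` B) \<le> card B'"
    using germs.independent_span_bound[OF fin(2)] by blast
  then show ?thesis by (simp add: card_image[OF inj])
qed

lemma quot_dim_eq:
  assumes "germs.subspace J" "basis_mod J B"
  shows "quot_dim J = card B"
  unfolding quot_dim_def
proof (rule the_equality)
  fix n assume "\<exists>B. basis_mod J B \<and> card B = n"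
  then obtain B' where "basis_mod J B'" "card B' = n" by blast
  with assms show "n = card B" using basis_mod_card_le[OF assms(1)] by (metis le_antisym)
qed (use assms in blast)

lemma basis_mod_insert:
  assumes J: "germs.subspace J" and J': "germs.subspace J'" and sub: "J' \<subseteq> J"
    and f: "f \<in> J" "f \<notin> J'" and codim: "\<And>g. g \<in> J \<Longrightarrow> \<exists>d. g - const_germ d * f \<in> J'"
    and B: "basis_mod J B"
  shows "basis_mod J' (insert f B)" "f \<notin> B"
proof -
  have fin: "finite B" using B by (simp add: basis_mod_def)
  show fB: "f \<notin> B"
  proof
    assume "f \<in> B"
    have "(\<Sum>b\<in>B. const_germ (if b = f then 1 else 0) * b) = (\<Sum>b\<in>B. if b = f then f else 0)"
      by (intro sum.cong) (auto simp: const_germ_simps)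
    also have "\<dots> = f" using fin \<open>f \<in> B\<close> by simp
    finally have "(\<Sum>b\<in>B. const_germ (if b = f then 1 else 0) * b) \<in> J" using f by simp
    moreover have "\<forall>c. (\<Sum>b\<in>B. const_germ (c b) * b) \<in> J \<longrightarrow> (\<forall>b\<in>B. c b = 0)"
      using B unfolding basis_mod_def by blast
    ultimately have "\<forall>b\<in>B. (if b = f then 1 else 0 :: complex) = 0" by (elim allE impE)
    with \<open>f \<in> B\<close> show False by auto
  qed
  show "basis_mod J' (insert f B)"
    unfolding basis_mod_def
  proof (intro conjI allI impI)
    fix g
    obtain c where c: "g - (\<Sum>b\<in>B. const_germ (c b) * b) \<in> J"
      using B unfolding basis_mod_def by blast
    obtain d where d: "g - (\<Sum>b\<in>B. const_germ (c b) * b) - const_germ d * f \<in> J'"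
      using codim[OF c] by blast
    have "(\<Sum>b\<in>B. const_germ ((c(f := d)) b) * b) = (\<Sum>b\<in>B. const_germ (c b) * b)"
      using fB by (intro sum.cong) auto
    then have "(\<Sum>b\<in>insert f B. const_germ ((c(f := d)) b) * b)
        = const_germ d * f + (\<Sum>b\<in>B. const_germ (c b) * b)"
      using fin fB by simp
    with d have "g - (\<Sum>b\<in>insert f B. const_germ ((c(f := d)) b) * b) \<in> J'"
      by (metis diff_diff_add add.commute)
    then show "\<exists>c. g - (\<Sum>b\<in>insert f B. const_germ (c b) * b) \<in> J'" by blast
  next
    fix c assume c: "(\<Sum>b\<in>insert f B. const_germ (c b) * b) \<in> J'"
    have split: "(\<Sum>b\<in>insert f B. const_germ (c b) * b)
        = const_germ (c f) * f + (\<Sum>b\<in>B. const_germ (c b) * b)"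
      using fin fB by simp
    have "(\<Sum>b\<in>insert f B. const_germ (c b) * b) - const_germ (c f) * f \<in> J"
      using c sub by (intro germs.subspace_diff[OF J] germs.subspace_scale[OF J] f(1)) auto
    then have "(\<Sum>b\<in>B. const_germ (c b) * b) \<in> J" by (simp add: split)
    then have cB: "\<forall>b\<in>B. c b = 0" using B unfolding basis_mod_def by blast
    then have "(\<Sum>b\<in>B. const_germ (c b) * b) = 0" by (intro sum.neutral) (simp add: const_germ_simps)
    then have "const_germ (c f) * f \<in> J'" using c split by simp
    then have "const_germ (inverse (c f)) * (const_germ (c f) * f) \<in> J'"
      by (rule germs.subspace_scale[OF J'])
    then have "c f \<noteq> 0 \<Longrightarrow> f \<in> J'" by (simp add: mult.assoc[symmetric] const_germ_simps(2) flip: const_germ_simps(4))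
    with f(2) cB show "\<forall>b\<in>insert f B. c b = 0" by blast
  qed (use fin in simp)
qed

section \<open>Filtrations by orders of vanishing\<close>

text \<open>
  Membership in each ideal is the vanishing of finitely many linear functionals, namely Taylor
  coefficients along the branches. Raising one coordinate by one adds one functional, so the
  dimension of the quotient grows by at most one.
\<close>
locale germ_filtration =
  fixes r :: nat and \<phi> :: "nat \<Rightarrow> hgerm \<Rightarrow> complex fps" and J :: "(nat \<Rightarrow>\<^sub>0 int) \<Rightarrow> hgerm set"
  assumes \<phi>_add: "k \<in> {1..r} \<Longrightarrow> \<phi> k (f + g) = \<phi> k f + \<phi> k g"
    and \<phi>_scale: "k \<in> {1..r} \<Longrightarrow> \<phi> k (const_germ c * f) = fps_const c * \<phi> k f"
    and J_def: "J v = {f. \<forall>k\<in>{1..r}. \<forall>i<nat (Poly_Mapping.lookup v k). \<phi> k f $ i = 0}"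
begin

lemma \<phi>_0: "k \<in> {1..r} \<Longrightarrow> \<phi> k 0 = 0"
  using \<phi>_add[of k 0 0] by simp

lemma \<phi>_diff: "k \<in> {1..r} \<Longrightarrow> \<phi> k (f - g) = \<phi> k f - \<phi> k g"
  using \<phi>_add[of k "f - g" g] by simp

lemma subspace_J: "germs.subspace (J v)"
  by (auto simp: germs.subspace_def J_def \<phi>_0 \<phi>_add \<phi>_scale)

lemma J_shift:
  assumes k: "k \<in> {1..r}"
  shows "Poly_Mapping.lookup v k < 0 \<Longrightarrow> J (v + unit_vec k) = J v"
    and "0 \<le> Poly_Mapping.lookup v k \<Longrightarrow>
      J (v + unit_vec k) = {f \<in> J v. \<phi> k f $ nat (Poly_Mapping.lookup v k) = 0}"
proof -
  have other: "Poly_Mapping.lookup (v + unit_vec k) j = Poly_Mapping.lookup v j" if "j \<noteq> k" for j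
    using that by (simp add: lookup_add lookup_single)
  have kk: "Poly_Mapping.lookup (v + unit_vec k) k = Poly_Mapping.lookup v k + 1"
    by (simp add: lookup_add)
  have split: "J w = {f. (\<forall>i<nat (Poly_Mapping.lookup w k). \<phi> k f $ i = 0) \<and>
      (\<forall>j\<in>{1..r} - {k}. \<forall>i<nat (Poly_Mapping.lookup w j). \<phi> j f $ i = 0)}" for w
    unfolding J_def using k by blast
  show "J (v + unit_vec k) = J v" if "Poly_Mapping.lookup v k < 0"
    using that unfolding split[of "v + unit_vec k"] split[of v] by (auto simp: other kk)
  show "J (v + unit_vec k) = {f \<in> J v. \<phi> k f $ nat (Poly_Mapping.lookup v k) = 0}" if "0 \<le> Poly_Mapping.lookup v k"
  proof -
    have "nat (Poly_Mapping.lookup v k + 1) = Suc (nat (Poly_Mapping.lookup v k))" using that by simp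
    then show ?thesis
      unfolding split[of "v + unit_vec k"] split[of v] by (auto simp: other kk less_Suc_eq)
  qed
qed

lemma basis_mod_J_step:
  assumes k: "k \<in> {1..r}" and B: "basis_mod (J v) B" and f: "f \<in> J v" "f \<notin> J (v + unit_vec k)"
  shows "basis_mod (J (v + unit_vec k)) (insert f B)" "f \<notin> B"
proof -
  have nn: "0 \<le> Poly_Mapping.lookup v k" using J_shift(1)[OF k] f by force
  let ?n = "nat (Poly_Mapping.lookup v k)"
  note J' = J_shift(2)[OF k nn]
  have nz: "\<phi> k f $ ?n \<noteq> 0" using f J' by blast
  have "\<exists>d. g - const_germ d * f \<in> J (v + unit_vec k)" if g: "g \<in> J v" for g
  proof (intro exI)
    let ?d = "\<phi> k g $ ?n / \<phi> k f $ ?n"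
    have "g - const_germ ?d * f \<in> J v"
      by (intro germs.subspace_diff[OF subspace_J] germs.subspace_scale[OF subspace_J] f g)
    then show "g - const_germ ?d * f \<in> J (v + unit_vec k)"
      using nz by (simp add: J' \<phi>_diff[OF k] \<phi>_scale[OF k])
  qed
  then show "basis_mod (J (v + unit_vec k)) (insert f B)" "f \<notin> B"
    using J' by (intro basis_mod_insert[OF subspace_J subspace_J _ f _ B]; auto)+
qed

lemma ex_basis_mod_J: "\<exists>B. basis_mod (J v) B"
proof (induction "\<Sum>k\<in>{1..r}. nat (Poly_Mapping.lookup v k)" arbitrary: v rule: less_induct)
  case less
  show ?case
  proof (cases "\<forall>k\<in>{1..r}. Poly_Mapping.lookup v k \<le> 0")
    case True
    then have "J v = UNIV" by (auto simp: J_def)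
    then have "basis_mod (J v) {}" by (simp add: basis_mod_def)
    then show ?thesis by blast
  next
    case False
    then obtain k where k: "k \<in> {1..r}" "Poly_Mapping.lookup v k > 0" by force
    define w where "w = v - unit_vec k"
    have v: "v = w + unit_vec k" by (simp add: w_def)
    have "(\<Sum>j\<in>{1..r}. nat (Poly_Mapping.lookup w j)) < (\<Sum>j\<in>{1..r}. nat (Poly_Mapping.lookup v j))"
    proof (rule sum_strict_mono_ex1)
      show "\<forall>j\<in>{1..r}. nat (Poly_Mapping.lookup w j) \<le> nat (Poly_Mapping.lookup v j)"
        by (auto simp: w_def lookup_minus lookup_single when_def)
      show "\<exists>j\<in>{1..r}. nat (Poly_Mapping.lookup w j) < nat (Poly_Mapping.lookup v j)"
        using k by (intro bexI[of _ k]) (auto simp: w_def lookup_minus)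
    qed simp
    then obtain B where B: "basis_mod (J w) B" using less by blast
    have "J v \<subseteq> J w" using J_shift[OF k(1), of w] by (cases "Poly_Mapping.lookup w k < 0") (auto simp: v)
    show ?thesis
    proof (cases "J v = J w")
      case True
      with B show ?thesis by auto
    next
      case False
      then obtain f where "f \<in> J w" "f \<notin> J v" using \<open>J v \<subseteq> J w\<close> by blast
      then show ?thesis using basis_mod_J_step(1)[OF k(1) B] unfolding v by blast
    qed
  qed
qed

lemma quot_dim_J_step:
  assumes k: "k \<in> {1..r}" and f: "f \<in> J v" "f \<notin> J (v + unit_vec k)"
  shows "quot_dim (J (v + unit_vec k)) = Suc (quot_dim (J v))"
proof -
  obtain B where B: "basis_mod (J v) B" using ex_basis_mod_J by blast
  note step = basis_mod_J_step[OF k B f]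
  have "finite B" using B by (simp add: basis_mod_def)
  then show ?thesis
    using quot_dim_eq[OF subspace_J step(1)] quot_dim_eq[OF subspace_J B] step(2) by simp
qed

lemma quot_dim_J_0: "quot_dim (J 0) = 0"
proof -
  have "basis_mod (J 0) {}" by (simp add: basis_mod_def J_def)
  from quot_dim_eq[OF subspace_J this] show ?thesis by simp
qed

end

section \<open>Values of convergent power series\<close>

text \<open>
  A polydisc of radius \<open>\<rho>\<close> whose double is still controlled by Cauchy estimates. The factor \<open>2\<close> makes
  the terms of the series on the polydisc decrease like \<open>2^(- i - j)\<close>, so that all rearrangements
  and the uniform convergence follow by comparison with a geometric series.
\<close>
definition germ_dom :: "hgerm \<Rightarrow> real \<Rightarrow> real \<Rightarrow> bool" where
  "germ_dom f \<rho> M \<longleftrightarrow> \<rho> > 0 \<and> (\<forall>i j. norm (series_of f $ i $ j) * (2 * \<rho>) ^ (i + j) \<le> M)"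

lemma germ_dom_ex: "\<exists>\<rho> M. germ_dom f \<rho> M"
proof -
  have "convergent2 (series_of f)" using series_of by simp
  then obtain M R where R: "0 < R" and b: "\<And>i j. norm (series_of f $ i $ j) \<le> M * R ^ (i + j)"
    unfolding convergent2_iff_bound by blast
  have "norm (series_of f $ i $ j) * (2 * (1 / (2 * R))) ^ (i + j) \<le> M" for i j
    using mult_right_mono[OF b, of "(1 / R) ^ (i + j)" i j] R by (simp add: power_divide)
  then show ?thesis unfolding germ_dom_def using R by (intro exI[of _ "1 / (2 * R)"] exI[of _ M]) auto
qed

lemma germ_dom_mono:
  assumes "germ_dom f \<rho> M" "0 < \<rho>'" "\<rho>' \<le> \<rho>"
  shows "germ_dom f \<rho>' M"
  unfolding germ_dom_def
proof (intro conjI allI)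
  fix i j
  have "norm (series_of f $ i $ j) * (2 * \<rho>') ^ (i + j) \<le> norm (series_of f $ i $ j) * (2 * \<rho>) ^ (i + j)"
    using assms by (intro mult_left_mono power_mono) auto
  also have "\<dots> \<le> M" using assms(1) by (simp add: germ_dom_def)
  finally show "norm (series_of f $ i $ j) * (2 * \<rho>') ^ (i + j) \<le> M" .
qed (use assms in simp)

lemma germ_dom_common:
  obtains \<rho> M N where "\<rho> > 0" "germ_dom f \<rho> M" "germ_dom g \<rho> N"
proof -
  obtain \<rho>1 M \<rho>2 N where *: "germ_dom f \<rho>1 M" "germ_dom g \<rho>2 N" using germ_dom_ex by meson
  then have "\<rho>1 > 0" "\<rho>2 > 0" by (auto simp: germ_dom_def)
  with * show ?thesis
    by (intro that[of "min \<rho>1 \<rho>2" M N]) (auto intro: germ_dom_mono)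
qed

lemma geometric_half: "summable (\<lambda>j. M * (1 / 2 :: real) ^ j)" "suminf (\<lambda>j. M * (1 / 2 :: real) ^ j) = 2 * M"
proof -
  have "(\<lambda>j. (1 / 2 :: real) ^ j) sums 2" using geometric_sums[of "1 / 2 :: real"] by simp
  then have "(\<lambda>j. M * (1 / 2 :: real) ^ j) sums (M * 2)" by (rule sums_mult)
  then show "summable (\<lambda>j. M * (1 / 2 :: real) ^ j)" "suminf (\<lambda>j. M * (1 / 2 :: real) ^ j) = 2 * M"
    by (simp_all add: sums_iff)
qed

lemma germ_dom_term:
  assumes "germ_dom f \<rho> M" "norm x \<le> \<rho>" "norm y \<le> \<rho>"
  shows "norm (series_of f $ i $ j * x ^ i * y ^ j) \<le> M * (1 / 2) ^ i * (1 / 2) ^ j"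
proof -
  have \<rho>: "\<rho> > 0" using assms by (simp add: germ_dom_def)
  have "norm (series_of f $ i $ j * x ^ i * y ^ j) \<le> norm (series_of f $ i $ j) * \<rho> ^ i * \<rho> ^ j"
    unfolding norm_mult norm_power using assms \<rho> by (intro mult_mono power_mono) auto
  also have "\<dots> = norm (series_of f $ i $ j) * (2 * \<rho>) ^ (i + j) * (1 / 2) ^ i * (1 / 2) ^ j"
    by (simp add: power_add power_mult_distrib power_divide)
  also have "\<dots> \<le> M * (1 / 2) ^ i * (1 / 2) ^ j"
    using assms(1) by (intro mult_right_mono) (auto simp: germ_dom_def)
  finally show ?thesis .
qed

lemma germ_dom_conv_radius:
  assumes "germ_dom f \<rho> M" "norm y \<le> \<rho>"
  shows "ereal (norm y) < fps_conv_radius (series_of f $ i)"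
proof -
  have \<rho>: "\<rho> > 0" using assms by (simp add: germ_dom_def)
  \<comment> \<open>Any radius strictly between \<open>\<rho>\<close> and \<open>2 * \<rho>\<close> would do.\<close>
  let ?z = "complex_of_real (3 / 2 * \<rho>)"
  have "summable (\<lambda>j. series_of f $ i $ j * ?z ^ j)"
  proof (rule summable_comparison_test)
    show "summable (\<lambda>j. M / (2 * \<rho>) ^ i * (3 / 4 :: real) ^ j)"
      by (intro summable_mult summable_geometric) simp
    have "norm (series_of f $ i $ j * ?z ^ j) \<le> M / (2 * \<rho>) ^ i * (3 / 4) ^ j" for j
    proof -
      have "norm (series_of f $ i $ j * ?z ^ j) = norm (series_of f $ i $ j) * (2 * \<rho>) ^ (i + j) * ((3 / 4) ^ j / (2 * \<rho>) ^ i)"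
      proof -
        have "(2 * \<rho>) ^ (i + j) * ((3 / 4) ^ j / (2 * \<rho>) ^ i) = (2 * \<rho> * (3 / 4)) ^ j"
          using \<rho> by (simp only: power_add power_mult_distrib) simp
        also have "2 * \<rho> * (3 / 4) = norm ?z" using \<rho> by simp
        finally show ?thesis by (simp only: norm_mult norm_power mult.assoc)
      qed
      also have "\<dots> \<le> M * ((3 / 4) ^ j / (2 * \<rho>) ^ i)"
        using assms(1) \<rho> by (intro mult_right_mono) (auto simp: germ_dom_def)
      finally show ?thesis by simp
    qed
    then show "\<exists>N. \<forall>j\<ge>N. norm (series_of f $ i $ j * ?z ^ j) \<le> M / (2 * \<rho>) ^ i * (3 / 4) ^ j" by blast
  qed
  then have "norm ?z \<le> fps_conv_radius (series_of f $ i)"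
    unfolding fps_conv_radius_def by (rule conv_radius_geI)
  moreover have "norm y < norm ?z" using assms(2) \<rho> by simp
  ultimately show ?thesis by (meson ereal_less_eq(3) less_ereal.simps(1) order_less_le_trans)
qed

lemma germ_dom_row:
  assumes "germ_dom f \<rho> M" "norm x \<le> \<rho>" "norm y \<le> \<rho>"
  shows "(\<lambda>j. series_of f $ i $ j * x ^ i * y ^ j) sums (eval_fps (series_of f $ i) y * x ^ i)"
    "norm (eval_fps (series_of f $ i) y * x ^ i) \<le> 2 * M * (1 / 2) ^ i"
proof -
  have "(\<lambda>j. series_of f $ i $ j * y ^ j) sums eval_fps (series_of f $ i) y"
    by (rule sums_eval_fps[OF germ_dom_conv_radius[OF assms(1,3)]])
  from sums_mult2[OF this, of "x ^ i"]
  show s: "(\<lambda>j. series_of f $ i $ j * x ^ i * y ^ j) sums (eval_fps (series_of f $ i) y * x ^ i)"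
    by (simp add: mult_ac)
  have "norm (suminf (\<lambda>j. series_of f $ i $ j * x ^ i * y ^ j)) \<le> (suminf (\<lambda>j. M * (1 / 2) ^ i * (1 / 2) ^ j))"
    using geometric_half(1)[of "M * (1 / 2) ^ i"] germ_dom_term[OF assms] by (intro norm_suminf_le) auto
  then show "norm (eval_fps (series_of f $ i) y * x ^ i) \<le> 2 * M * (1 / 2) ^ i"
    using s by (simp add: sums_iff geometric_half(2)[of "M * (1 / 2) ^ i"])
qed

lemma germ_dom_summable:
  assumes "germ_dom f \<rho> M" "norm x \<le> \<rho>" "norm y \<le> \<rho>"
  shows "summable (\<lambda>i. norm (eval_fps (series_of f $ i) y * x ^ i))"
  using geometric_half(1)[of "2 * M"] germ_dom_row(2)[OF assms]
  by (intro summable_comparison_test[OF _ geometric_half(1)[of "2 * M"]]) auto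

text \<open>
  Summation by rows, which reduces the unordered double sum to power series in one variable.
\<close>
lemma germ_eval_sums:
  assumes "germ_dom f \<rho> M" "norm x \<le> \<rho>" "norm y \<le> \<rho>"
  shows "germ_eval f (x, y) = suminf (\<lambda>i. eval_fps (series_of f $ i) y * x ^ i)"
proof -
  let ?t = "\<lambda>i j. series_of f $ i $ j * x ^ i * y ^ j"
  have geo: "(\<lambda>i. (1 / 2 :: real) ^ i) summable_on UNIV"
    by (subst summable_on_UNIV_nonneg_real_iff) (auto intro: summable_geometric)
  have "(\<lambda>(i, j). (1 / 2 :: real) ^ i * (1 / 2) ^ j) summable_on (UNIV \<times> UNIV)"
    by (rule summable_on_SigmaI[where g = "\<lambda>i. (1 / 2 :: real) ^ i * infsum (\<lambda>j. (1 / 2) ^ j) UNIV"])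
      (auto intro!: has_sum_cmult_right summable_on_cmult_left geo has_sum_infsum)
  then have "(\<lambda>p. M * (\<lambda>(i, j). (1 / 2 :: real) ^ i * (1 / 2) ^ j) p) summable_on (UNIV \<times> UNIV)"
    by (intro summable_on_cmult_right) simp
  then have "(\<lambda>p. norm ((\<lambda>(i, j). ?t i j) p)) summable_on (UNIV \<times> UNIV)"
    by (rule summable_on_comparison_test) (use germ_dom_term[OF assms] in \<open>auto simp: mult.assoc\<close>)
  then have abs: "(\<lambda>(i, j). ?t i j) summable_on (UNIV \<times> UNIV)"
    by (rule abs_summable_summable)
  have row: "infsum (?t i) UNIV = eval_fps (series_of f $ i) y * x ^ i" for i
  proof (rule infsumI, rule norm_summable_imp_has_sum)
    show "summable (\<lambda>j. norm (?t i j))"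
      by (rule summable_comparison_test[OF _ geometric_half(1)[of "M * (1 / 2) ^ i"]])
        (use germ_dom_term[OF assms] in auto)
  qed (rule germ_dom_row(1)[OF assms])
  have "germ_eval f (x, y) = infsum (\<lambda>(i, j). ?t i j) (UNIV \<times> UNIV)"
    by (simp add: germ_eval_def)
  also have "\<dots> = infsum (\<lambda>i. infsum (?t i) UNIV) UNIV"
    using infsum_Sigma'_banach[OF abs] by simp
  also have "\<dots> = suminf (\<lambda>i. eval_fps (series_of f $ i) y * x ^ i)"
    unfolding row
    by (rule infsumI, rule norm_summable_imp_has_sum)
      (rule germ_dom_summable[OF assms], rule summable_sums, rule summable_norm_cancel, rule germ_dom_summable[OF assms])
  finally show ?thesis .
qed

lemma eventually_germ_dom:
  assumes "\<rho> > 0"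
  shows "\<forall>\<^sub>F p in nhds (0 :: complex \<times> complex). norm (fst p) \<le> \<rho> \<and> norm (snd p) \<le> \<rho>"
proof -
  have "eventually (\<lambda>p. p \<in> ball (0 :: complex \<times> complex) \<rho>) (nhds 0)"
    by (rule eventually_nhds_in_open) (use assms in auto)
  then show ?thesis
  proof eventually_elim
    case (elim p)
    then show ?case
      using norm_fst_le[of "fst p" "snd p"] norm_snd_le[of "snd p" "fst p"] by simp
  qed
qed

lemma germ_eval_const [simp]: "germ_eval (const_germ c) p = c"
proof -
  have eq: "series_of (const_germ c) $ i $ j = (if i = 0 \<and> j = 0 then c else 0)" for i j
    by transfer (auto simp: fps_const_def)
  have "germ_eval (const_germ c) p = infsum (\<lambda>(i, j). series_of (const_germ c) $ i $ j * fst p ^ i * snd p ^ j) {(0, 0)}"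
    unfolding germ_eval_def by (rule infsum_cong_neutral) (auto simp: eq split: if_splits)
  then show ?thesis by (simp add: eq)
qed

lemma germ_eval_add: "\<forall>\<^sub>F p in nhds 0. germ_eval (f + g) p = germ_eval f p + germ_eval g p"
proof -
  obtain \<rho> M N where \<rho>: "\<rho> > 0" and f: "germ_dom f \<rho> M" and g: "germ_dom g \<rho> N" by (rule germ_dom_common)
  have fg: "germ_dom (f + g) \<rho> (M + N)"
    unfolding germ_dom_def
  proof (intro conjI allI)
    fix i j
    have "norm (series_of (f + g) $ i $ j) * (2 * \<rho>) ^ (i + j)
        \<le> (norm (series_of f $ i $ j) + norm (series_of g $ i $ j)) * (2 * \<rho>) ^ (i + j)"
      using \<rho> by (intro mult_right_mono) (auto simp: plus_hgerm.rep_eq intro: norm_triangle_ineq)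
    also have "\<dots> \<le> M + N"
      using f g unfolding germ_dom_def distrib_right by (intro add_mono) auto
    finally show "norm (series_of (f + g) $ i $ j) * (2 * \<rho>) ^ (i + j) \<le> M + N" .
  qed (fact \<rho>)
  show ?thesis
    using eventually_germ_dom[OF \<rho>]
  proof eventually_elim
    case (elim p)
    obtain x y where p: "p = (x, y)" by (cases p)
    with elim have xy: "norm x \<le> \<rho>" "norm y \<le> \<rho>" by auto
    note [simp] = germ_dom_conv_radius[OF f xy(2)] germ_dom_conv_radius[OF g xy(2)]
    have "germ_eval (f + g) p = suminf (\<lambda>i. eval_fps (series_of f $ i) y * x ^ i + eval_fps (series_of g $ i) y * x ^ i)"
      unfolding p germ_eval_sums[OF fg xy] by (simp add: plus_hgerm.rep_eq eval_fps_add distrib_right)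
    also have "\<dots> = germ_eval f p + germ_eval g p"
      unfolding p germ_eval_sums[OF f xy] germ_eval_sums[OF g xy]
      by (rule suminf_add[symmetric]; rule summable_norm_cancel)
        (rule germ_dom_summable[OF f xy] germ_dom_summable[OF g xy])+
    finally show ?case .
  qed
qed

lemma eval_fps_sum:
  assumes "\<And>i. i \<in> I \<Longrightarrow> ereal (norm z) < fps_conv_radius (F i)"
  shows "ereal (norm z) < fps_conv_radius (\<Sum>i\<in>I. F i) \<and> eval_fps (\<Sum>i\<in>I. F i) z = (\<Sum>i\<in>I. eval_fps (F i) (z :: complex))"
  using assms
proof (induction I rule: infinite_finite_induct)
  case (insert i I)
  then have IH: "ereal (norm z) < fps_conv_radius (\<Sum>i\<in>I. F i)" "ereal (norm z) < fps_conv_radius (F i)"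
    "eval_fps (\<Sum>i\<in>I. F i) z = (\<Sum>i\<in>I. eval_fps (F i) z)" by auto
  have "ereal (norm z) < fps_conv_radius (F i + (\<Sum>i\<in>I. F i))"
    using fps_conv_radius_add[of "F i" "\<Sum>i\<in>I. F i"] IH by (meson min_less_iff_conj order_less_le_trans)
  with IH insert show ?case by (simp add: eval_fps_add)
qed auto

text \<open>
  Two Cauchy products: one in \<open>y\<close> for the rows, and one in \<open>x\<close> for the series of row values.
\<close>
lemma germ_eval_mult: "\<forall>\<^sub>F p in nhds 0. germ_eval (f * g) p = germ_eval f p * germ_eval g p"
proof -
  obtain \<rho>0 M0 N0 where \<rho>0: "\<rho>0 > 0" and f0: "germ_dom f \<rho>0 M0" and g0: "germ_dom g \<rho>0 N0" by (rule germ_dom_common)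
  obtain \<rho>1 K where fg0: "germ_dom (f * g) \<rho>1 K" using germ_dom_ex by blast
  define \<rho> where "\<rho> = min \<rho>0 \<rho>1"
  have \<rho>: "\<rho> > 0" using \<rho>0 fg0 by (auto simp: \<rho>_def germ_dom_def)
  have f: "germ_dom f \<rho> M0" and g: "germ_dom g \<rho> N0" and fg: "germ_dom (f * g) \<rho> K"
    using f0 g0 fg0 \<rho> by (auto intro: germ_dom_mono simp: \<rho>_def)
  show ?thesis
    using eventually_germ_dom[OF \<rho>]
  proof eventually_elim
    case (elim p)
    obtain x y where p: "p = (x, y)" by (cases p)
    with elim have xy: "norm x \<le> \<rho>" "norm y \<le> \<rho>" by auto
    let ?A = "\<lambda>i. eval_fps (series_of f $ i) y" and ?B = "\<lambda>i. eval_fps (series_of g $ i) y"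
    note cr = germ_dom_conv_radius[OF f xy(2)] germ_dom_conv_radius[OF g xy(2)]
    have crm: "ereal (norm y) < fps_conv_radius (series_of f $ i * series_of g $ j)" for i j
      using fps_conv_radius_mult[of "series_of f $ i" "series_of g $ j"] cr by (meson min_less_iff_conj order_less_le_trans)
    have row: "eval_fps (series_of (f * g) $ i) y * x ^ i = (\<Sum>k\<le>i. (?A k * x ^ k) * (?B (i - k) * x ^ (i - k)))" for i
    proof -
      have "series_of (f * g) $ i = (\<Sum>k\<le>i. series_of f $ k * series_of g $ (i - k))"
        by (simp add: times_hgerm.rep_eq fps_mult_nth atLeast0AtMost)
      then have "eval_fps (series_of (f * g) $ i) y = (\<Sum>k\<le>i. ?A k * ?B (i - k))"
        using eval_fps_sum[of "{..i}" y "\<lambda>k. series_of f $ k * series_of g $ (i - k)"] crm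
        by (simp add: eval_fps_mult cr)
      then have "eval_fps (series_of (f * g) $ i) y * x ^ i = (\<Sum>k\<le>i. (?A k * ?B (i - k)) * x ^ i)"
        by (simp add: sum_distrib_right)
      also have "\<dots> = (\<Sum>k\<le>i. (?A k * x ^ k) * (?B (i - k) * x ^ (i - k)))"
      proof (rule sum.cong)
        fix k assume "k \<in> {..i}"
        then have "x ^ i = x ^ k * x ^ (i - k)" by (simp flip: power_add)
        then show "(?A k * ?B (i - k)) * x ^ i = (?A k * x ^ k) * (?B (i - k) * x ^ (i - k))" by simp
      qed simp
      finally show ?thesis .
    qed
    have "germ_eval (f * g) p = suminf (\<lambda>i. \<Sum>k\<le>i. (?A k * x ^ k) * (?B (i - k) * x ^ (i - k)))"
      unfolding p germ_eval_sums[OF fg xy] row ..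
    also have "\<dots> = germ_eval f p * germ_eval g p"
      unfolding p germ_eval_sums[OF f xy] germ_eval_sums[OF g xy]
      by (rule Cauchy_product[symmetric]) (rule germ_dom_summable[OF f xy] germ_dom_summable[OF g xy])+
    finally show ?case .
  qed
qed

lemma analytic_germ_eval:
  assumes "(\<lambda>t. fst (\<gamma> t)) analytic_on {0}" "(\<lambda>t. snd (\<gamma> t)) analytic_on {0}" "\<gamma> 0 = 0"
  shows "(\<lambda>t. germ_eval f (\<gamma> t)) analytic_on {0}"
proof -
  obtain \<rho> M where f: "germ_dom f \<rho> M" using germ_dom_ex by blast
  then have \<rho>: "\<rho> > 0" by (simp add: germ_dom_def)
  obtain e1 e2 where e: "e1 > 0" "e2 > 0" "(\<lambda>t. fst (\<gamma> t)) holomorphic_on ball 0 e1" "(\<lambda>t. snd (\<gamma> t)) holomorphic_on ball 0 e2"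
    using assms(1,2) by (auto simp: analytic_on_def)
  have cont: "isCont (\<lambda>t. fst (\<gamma> t)) 0" "isCont (\<lambda>t. snd (\<gamma> t)) 0"
    using assms(1,2) by (auto intro: analytic_at_imp_isCont)
  then have tend: "((\<lambda>t. fst (\<gamma> t)) \<longlongrightarrow> 0) (nhds 0)" "((\<lambda>t. snd (\<gamma> t)) \<longlongrightarrow> 0) (nhds 0)"
    using assms(3) by (simp_all add: continuous_at tendsto_nhds_iff)
  have "\<forall>\<^sub>F t in nhds 0. fst (\<gamma> t) \<in> ball 0 \<rho> \<and> snd (\<gamma> t) \<in> ball 0 \<rho> \<and> t \<in> ball 0 (min e1 e2)"
    using e \<rho> tend by (intro eventually_conj topological_tendstoD eventually_nhds_in_open) auto
  then obtain S where S: "open S" "0 \<in> S"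
    and Sb: "\<And>t. t \<in> S \<Longrightarrow> norm (fst (\<gamma> t)) \<le> \<rho> \<and> norm (snd (\<gamma> t)) \<le> \<rho> \<and> t \<in> ball 0 (min e1 e2)"
    unfolding eventually_nhds by (auto simp: less_imp_le)
  have hol: "(\<lambda>t. fst (\<gamma> t)) holomorphic_on S" "(\<lambda>t. snd (\<gamma> t)) holomorphic_on S"
    by (rule holomorphic_on_subset[OF e(3)] holomorphic_on_subset[OF e(4)], use Sb in force)+
  let ?u = "\<lambda>i t. eval_fps (series_of f $ i) (snd (\<gamma> t)) * fst (\<gamma> t) ^ i"
  have "(\<lambda>t. suminf (\<lambda>i. ?u i t)) holomorphic_on S"
  proof (rule holomorphic_uniform_sequence[OF S(1)])
    fix n
    have "(eval_fps (series_of f $ i) \<circ> (\<lambda>t. snd (\<gamma> t))) holomorphic_on S" for i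
      by (rule holomorphic_on_compose_gen[OF hol(2) holomorphic_on_eval_fps[OF subset_refl]])
        (use germ_dom_conv_radius[OF f] Sb in \<open>auto simp: image_subset_iff\<close>)
    then show "(\<lambda>t. \<Sum>i<n. ?u i t) holomorphic_on S"
      using hol(1) by (intro holomorphic_intros) (simp add: o_def)
  next
    fix t assume "t \<in> S"
    then obtain d where d: "d > 0" "cball t d \<subseteq> S" using S(1) open_contains_cball by blast
    have "uniform_limit (cball t d) (\<lambda>n t. \<Sum>i<n. ?u i t) (\<lambda>t. suminf (\<lambda>i. ?u i t)) sequentially"
      by (rule Weierstrass_m_test[OF _ geometric_half(1)[of "2 * M"]])
        (use germ_dom_row(2)[OF f] Sb d in blast)
    with d show "\<exists>d>0. cball t d \<subseteq> S \<and> uniform_limit (cball t d) (\<lambda>n t. \<Sum>i<n. ?u i t) (\<lambda>t. suminf (\<lambda>i. ?u i t)) sequentially"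
      by blast
  qed
  moreover have "(suminf (\<lambda>i. ?u i t)) = germ_eval f (\<gamma> t)" if "t \<in> S" for t
    using germ_eval_sums[OF f] Sb[OF that] by (metis prod.collapse)
  ultimately have "(\<lambda>t. germ_eval f (\<gamma> t)) holomorphic_on S"
    by (simp cong: holomorphic_cong)
  then show ?thesis using S by (auto simp: analytic_at)
qed

section \<open>Pullback of germs along a parametrization\<close>
definition germ_arc :: "(complex \<Rightarrow> complex \<times> complex) \<Rightarrow> bool" where
  "germ_arc \<gamma> \<longleftrightarrow> (\<lambda>t. fst (\<gamma> t)) analytic_on {0} \<and> (\<lambda>t. snd (\<gamma> t)) analytic_on {0} \<and> \<gamma> 0 = 0"

text \<open>
  Replacing the order of vanishing by the Taylor series of \<open>f \<circ> \<gamma>\<close> turns the valuation conditions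
  into linear ones, and makes composition with \<open>\<gamma>\<close> a ring homomorphism.
\<close>
definition pullback :: "(complex \<Rightarrow> complex \<times> complex) \<Rightarrow> hgerm \<Rightarrow> complex fps" where
  "pullback \<gamma> f = fps_expansion (\<lambda>t. germ_eval f (\<gamma> t)) 0"

lemma uniformization_germ_arc: "uniformization \<gamma> S \<Longrightarrow> germ_arc \<gamma>"
  unfolding uniformization_def germ_arc_def analytic_on_def by auto

lemma germ_arc_tendsto:
  assumes "germ_arc \<gamma>"
  shows "filterlim \<gamma> (nhds 0) (nhds 0)"
proof -
  have "isCont (\<lambda>t. fst (\<gamma> t)) 0" "isCont (\<lambda>t. snd (\<gamma> t)) 0"
    using assms by (auto simp: germ_arc_def intro: analytic_at_imp_isCont)
  then have "isCont (\<lambda>t. (fst (\<gamma> t), snd (\<gamma> t))) 0" by (rule isCont_Pair)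
  then show ?thesis using assms by (simp add: germ_arc_def continuous_at tendsto_nhds_iff)
qed

lemma pullback_expansion:
  assumes "germ_arc \<gamma>"
  shows "(\<lambda>t. germ_eval f (\<gamma> t)) has_fps_expansion pullback \<gamma> f"
  unfolding pullback_def using assms
  by (intro analytic_at_imp_has_fps_expansion_0 analytic_germ_eval) (auto simp: germ_arc_def)

lemma pullback_eqI:
  assumes "germ_arc \<gamma>" "\<forall>\<^sub>F t in nhds 0. germ_eval f (\<gamma> t) = u t" "u has_fps_expansion F"
  shows "pullback \<gamma> f = F"
proof -
  have "(\<lambda>t. germ_eval f (\<gamma> t)) has_fps_expansion F"
    using assms(2,3) by (simp cong: has_fps_expansion_cong)
  then show ?thesis using pullback_expansion[OF assms(1)] fps_expansion_unique_complex by blast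
qed

lemma pullback_add:
  assumes "germ_arc \<gamma>" shows "pullback \<gamma> (f + g) = pullback \<gamma> f + pullback \<gamma> g"
  by (rule pullback_eqI[OF assms eventually_compose_filterlim[OF germ_eval_add germ_arc_tendsto[OF assms]]])
    (intro fps_expansion_intros pullback_expansion assms)

lemma pullback_mult:
  assumes "germ_arc \<gamma>" shows "pullback \<gamma> (f * g) = pullback \<gamma> f * pullback \<gamma> g"
  by (rule pullback_eqI[OF assms eventually_compose_filterlim[OF germ_eval_mult germ_arc_tendsto[OF assms]]])
    (intro fps_expansion_intros pullback_expansion assms)

lemma pullback_const:
  assumes "germ_arc \<gamma>" shows "pullback \<gamma> (const_germ c) = fps_const c"
  by (rule pullback_eqI[OF assms, where u = "\<lambda>_. c"]) auto

lemma pullback_eq_0_iff: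
  assumes "germ_arc \<gamma>"
  shows "pullback \<gamma> f = 0 \<longleftrightarrow> (\<forall>\<^sub>F t in nhds 0. germ_eval f (\<gamma> t) = 0)"
  using pullback_expansion[OF assms, of f] has_fps_expansion_0_iff fps_expansion_unique_complex by metis

lemma curve_ord_ge_iff:
  assumes "germ_arc \<gamma>"
  shows "enat n \<le> curve_ord \<gamma> f \<longleftrightarrow> (\<forall>i<n. pullback \<gamma> f $ i = 0)"
proof (cases "pullback \<gamma> f = 0")
  case True
  then have "curve_ord \<gamma> f = \<infinity>" using pullback_eq_0_iff[OF assms] by (simp add: curve_ord_def)
  with True show ?thesis by simp
next
  case False
  then have "curve_ord \<gamma> f = enat (subdegree (pullback \<gamma> f))"
    using pullback_eq_0_iff[OF assms] has_fps_expansion_zorder_0[OF pullback_expansion[OF assms] False]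
    by (simp add: curve_ord_def)
  then show ?thesis using False
    by (metis enat_ord_simps(1) nth_less_subdegree_zero order_less_le_trans subdegree_geI)
qed

lemma germ_filtration_Jideal:
  assumes "\<And>k. k \<in> {1..r} \<Longrightarrow> germ_arc (\<gamma> k)"
  shows "germ_filtration r (\<lambda>k. pullback (\<gamma> k)) (Jideal r \<gamma>)"
  by standard (use assms in \<open>auto simp: pullback_add pullback_mult pullback_const Jideal_def curve_ord_ge_iff\<close>)

section \<open>Interpolation at conjugate points\<close>
lemma ex_germ_fst:
  assumes "fps_conv_radius d > 0"
  shows "\<exists>f. \<forall>\<^sub>F p in nhds 0. germ_eval f p = eval_fps d (fst p)"
proof -
  obtain r where r: "r > 0" "ereal r < fps_conv_radius d"
    using ereal_dense2[OF assms] by (metis ereal_less(2) zero_ereal_def ereal_less_eq(3) less_ereal.simps(1))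
  have "summable (\<lambda>n. d $ n * complex_of_real r ^ n)"
    by (rule summable_fps) (use r in simp)
  then have "Bseq (\<lambda>n. d $ n * complex_of_real r ^ n)"
    by (intro convergent_imp_Bseq convergentI[of _ 0] summable_LIMSEQ_zero)
  then obtain M where M: "\<And>n. norm (d $ n * complex_of_real r ^ n) \<le> M" by (auto simp: Bseq_def)
  define a where "a = Abs_fps (\<lambda>i. fps_const (d $ i))"
  have M0: "M \<ge> 0" using order_trans[OF norm_ge_zero M] .
  have "norm (a $ i $ j) \<le> M * (1 / r) ^ (i + j)" for i j
  proof (cases "j = 0")
    case True
    have "norm (d $ i) * r ^ i \<le> M" using M[of i] r by (simp add: norm_mult norm_power)
    with True r show ?thesis by (simp add: a_def field_simps power_divide)
  next
    case False
    then show ?thesis using M0 r by (simp add: a_def fps_const_def)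
  qed
  then have "convergent2 a"
    unfolding convergent2_iff_bound using r by (intro exI[of _ M] exI[of _ "1 / r"]) auto
  then have ser: "series_of (hgerm_of a) = a" by (simp add: hgerm_of_inverse)
  obtain \<rho> M where \<rho>: "germ_dom (hgerm_of a) \<rho> M" using germ_dom_ex by blast
  then have "\<rho> > 0" by (simp add: germ_dom_def)
  have "\<forall>\<^sub>F p in nhds 0. germ_eval (hgerm_of a) p = eval_fps d (fst p)"
    using eventually_germ_dom[OF \<open>\<rho> > 0\<close>]
  proof eventually_elim
    case (elim p)
    then show ?case
      using germ_eval_sums[OF \<rho>, of "fst p" "snd p"]
      by (simp only: ser prod.collapse) (simp add: a_def, simp add: eval_fps_def)
  qed
  then show ?thesis by blast
qed

lemma ex_germ_snd: "\<exists>f. \<forall>\<^sub>F p in nhds 0. germ_eval f p = snd p"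
proof -
  define a :: "complex fps fps" where "a = fps_const fps_X"
  have a: "a $ i $ j = (if i = 0 \<and> j = 1 then 1 else 0)" for i j
    by (auto simp: a_def fps_const_def fps_X_def)
  have "convergent2 a"
    unfolding convergent2_iff_bound by (intro exI[of _ 1]) (auto simp: a)
  then have ser: "series_of (hgerm_of a) = a" by (simp add: hgerm_of_inverse)
  have "germ_eval (hgerm_of a) p = snd p" for p
  proof -
    have "germ_eval (hgerm_of a) p = infsum (\<lambda>(i, j). series_of (hgerm_of a) $ i $ j * fst p ^ i * snd p ^ j) {(0, 1)}"
      unfolding germ_eval_def by (rule infsum_cong_neutral) (auto simp: ser a split: if_splits)
    then show ?thesis by (simp add: ser a)
  qed
  then show ?thesis by (intro exI[of _ "hgerm_of a"] always_eventually) blast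
qed

lemma ex_germ_polynomial:
  assumes "\<And>j. fps_conv_radius (d j) > 0"
  shows "\<exists>f. \<forall>\<^sub>F p in nhds 0. germ_eval f p = (\<Sum>j<(n::nat). eval_fps (d j) (fst p) * snd p ^ j)"
proof (induction n)
  case 0
  have "germ_eval (const_germ 0) p = 0" for p by simp
  then show ?case by (intro exI[of _ "const_germ 0"]) simp
next
  case (Suc n)
  obtain f where f: "\<forall>\<^sub>F p in nhds 0. germ_eval f p = (\<Sum>j<n. eval_fps (d j) (fst p) * snd p ^ j)"
    using Suc by blast
  obtain x where x: "\<forall>\<^sub>F p in nhds 0. germ_eval x p = eval_fps (d n) (fst p)"
    using ex_germ_fst[OF assms] by blast
  obtain y where y: "\<forall>\<^sub>F p in nhds 0. germ_eval y p = snd p"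
    using ex_germ_snd by blast
  have pow: "\<forall>\<^sub>F p in nhds 0. germ_eval (y ^ k) p = snd p ^ k" for k
  proof (induction k)
    case 0
    have "germ_eval 1 p = 1" for p using germ_eval_const[of 1 p] by (simp add: const_germ_simps)
    then show ?case by simp
  next
    case (Suc k)
    show ?case using Suc y germ_eval_mult[of y "y ^ k"] by eventually_elim simp
  qed
  have "\<forall>\<^sub>F p in nhds 0. germ_eval (f + x * y ^ n) p = (\<Sum>j<Suc n. eval_fps (d j) (fst p) * snd p ^ j)"
    using f x pow[of n] germ_eval_mult[of x "y ^ n"] germ_eval_add[of f "x * y ^ n"]
    by eventually_elim simp
  then show ?case by blast
qed

text \<open>
  Comparing Taylor coefficients with those of \<open>c(\<omega> \<sigma>)\<close> for a primitive root of unity \<open>\<omega>\<close>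
  shows that only the exponents divisible by \<open>m\<close> occur.
\<close>
lemma root_unity_invariant_imp_power:
  assumes m: "m > 0" and \<delta>: "\<delta> > 0" and hol: "c holomorphic_on ball 0 \<delta>"
    and inv: "\<And>\<omega> \<sigma>. \<omega> ^ m = 1 \<Longrightarrow> \<sigma> \<in> ball 0 \<delta> \<Longrightarrow> c (\<omega> * \<sigma>) = c \<sigma>"
  shows "\<exists>d. fps_conv_radius d > 0 \<and> (\<forall>\<sigma>\<in>ball 0 \<delta>. eval_fps d (\<sigma> ^ m) = c \<sigma>)"
proof -
  define F where "F = fps_expansion c 0"
  have F: "c has_fps_expansion F"
    unfolding F_def using hol \<delta> by (intro analytic_at_imp_has_fps_expansion_0) (auto simp: analytic_on_def)
  \<comment> \<open>A primitive \<open>m\<close>-th root of unity.\<close>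
  define \<omega> where "\<omega> = cis (2 * pi / m)"
  have \<omega>: "\<omega> ^ m = 1" unfolding \<omega>_def Complex.DeMoivre using m by simp
  have sums: "(\<lambda>l. F $ l * \<sigma> ^ l) sums c \<sigma>" if "\<sigma> \<in> ball 0 \<delta>" for \<sigma>
    by (rule has_fps_expansion_imp_sums_complex[OF F, of "ereal \<delta>"]) (use that hol in auto)
  have F0: "F $ l = 0" if "\<not> m dvd l" for l
  proof -
    have "(c \<circ> (\<lambda>t. \<omega> * t)) has_fps_expansion fps_compose F (fps_const \<omega> * fps_X)"
      by (intro fps_expansion_intros F) auto
    moreover have "(c \<circ> (\<lambda>t. \<omega> * t)) has_fps_expansion F"
    proof -
      have "\<forall>\<^sub>F t in nhds 0. (c \<circ> (\<lambda>t. \<omega> * t)) t = c t"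
        using eventually_nhds_in_open[of "ball 0 \<delta>" 0] \<delta> inv[OF \<omega>] by (auto elim: eventually_mono)
      with F show ?thesis by (simp cong: has_fps_expansion_cong)
    qed
    ultimately have "fps_compose F (fps_const \<omega> * fps_X) = F" by (rule fps_expansion_unique_complex)
    then have "F $ l = \<omega> ^ l * F $ l" by (metis fps_nth_compose_linear)
    moreover have "\<omega> ^ l \<noteq> 1"
    proof
      assume "\<omega> ^ l = 1"
      then have "cis (2 * pi * (real l / real m)) = 1"
        by (simp add: \<omega>_def Complex.DeMoivre mult_ac)
      then obtain k :: int where "2 * pi * (real l / real m) = 2 * pi * of_int k"
        by (auto simp: cis_conv_exp exp_eq_1)
      then have "real l = of_int k * real m" using m by (simp add: field_simps)
      then have "int l = k * int m" by (metis of_int_eq_iff of_int_mult of_int_of_nat_eq)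
      then have "int m dvd int l" by simp
      with that show False by (simp add: int_dvd_int_iff)
    qed
    ultimately show ?thesis by (metis mult_cancel_right1)
  qed
  define d where "d = Abs_fps (\<lambda>i. F $ (m * i))"
  have dsums: "(\<lambda>i. d $ i * (\<sigma> ^ m) ^ i) sums c \<sigma>" if "\<sigma> \<in> ball 0 \<delta>" for \<sigma>
  proof -
    have "strict_mono (\<lambda>i. m * i)" using m by (auto simp: strict_mono_def)
    moreover have "F $ l * \<sigma> ^ l = 0" if "l \<notin> range (\<lambda>i. m * i)" for l
      using that F0[of l] by (auto elim: dvdE)
    ultimately have "(\<lambda>i. F $ (m * i) * \<sigma> ^ (m * i)) sums c \<sigma> \<longleftrightarrow> (\<lambda>l. F $ l * \<sigma> ^ l) sums c \<sigma>"
      by (rule sums_mono_reindex)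
    with sums[OF that] show ?thesis by (simp add: d_def power_mult)
  qed
  have "fps_conv_radius d > 0"
  proof -
    have "summable (\<lambda>i. d $ i * (complex_of_real (\<delta> / 2) ^ m) ^ i)"
      using dsums[of "complex_of_real (\<delta> / 2)"] \<delta> by (auto simp: sums_iff)
    then have "fps_conv_radius d \<ge> norm (complex_of_real (\<delta> / 2) ^ m)"
      unfolding fps_conv_radius_def by (rule conv_radius_geI)
    moreover have "norm (complex_of_real (\<delta> / 2) ^ m) > 0" using \<delta> by simp
    ultimately show ?thesis by (metis ereal_less(2) order_less_le_trans)
  qed
  moreover have "\<forall>\<sigma>\<in>ball 0 \<delta>. eval_fps d (\<sigma> ^ m) = c \<sigma>"
    using dsums by (simp add: eval_fps_def sums_iff)
  ultimately show ?thesis by blast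
qed

lemma holomorphic_coeff_linear_factors:
  assumes "\<And>z. z \<in> A \<Longrightarrow> a z holomorphic_on S"
  shows "(\<lambda>\<sigma>. coeff (\<Prod>z\<in>A. [:- a z \<sigma>, 1:]) j) holomorphic_on S"
  using assms
proof (induction A arbitrary: j rule: infinite_finite_induct)
  case (insert z A)
  have "coeff (\<Prod>z\<in>insert z A. [:- a z \<sigma>, 1:]) j = - a z \<sigma> * coeff (\<Prod>z\<in>A. [:- a z \<sigma>, 1:]) j
      + (case j of 0 \<Rightarrow> 0 | Suc i \<Rightarrow> coeff (\<Prod>z\<in>A. [:- a z \<sigma>, 1:]) i)" for \<sigma>
    using insert by (simp add: coeff_pCons)
  moreover have "(\<lambda>\<sigma>. - a z \<sigma> * coeff (\<Prod>z\<in>A. [:- a z \<sigma>, 1:]) j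
      + (case j of 0 \<Rightarrow> 0 | Suc i \<Rightarrow> coeff (\<Prod>z\<in>A. [:- a z \<sigma>, 1:]) i)) holomorphic_on S"
    using insert by (cases j) (auto intro!: holomorphic_intros)
  ultimately show ?case by (simp only:)
qed auto

text \<open>
  The polynomial \<open>\<Sum>\<^sub>\<zeta> (\<zeta> \<sigma>)^n \<Prod>\<^sub>\<xi>\<^sub>\<noteq>\<^sub>\<zeta> (Y - y(\<xi> \<sigma>))\<close> is the Lagrange
  interpolation of \<open>(\<zeta> \<sigma>)^n\<close> at the conjugates \<open>y(\<zeta> \<sigma>)\<close>, cleared of denominators. It is symmetric
  under \<open>\<sigma> \<mapsto> \<omega> \<sigma>\<close>, so its coefficients are holomorphic in \<open>x = \<sigma>^m\<close> and it is a germ in two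
  variables; at \<open>Y = y(\<sigma>)\<close> only the summand with \<open>\<zeta> = 1\<close> is left. The product on the right does not
  depend on \<open>n\<close>: it generates an ideal of the ring of convergent power series in \<open>\<sigma>\<close> that is
  contained in the image of the local ring.
\<close>
lemma lagrange_germ:
  fixes y :: "complex \<Rightarrow> complex"
  assumes m: "m > 0" and \<delta>: "\<delta> > 0" and hol: "y holomorphic_on ball 0 \<delta>"
  shows "\<exists>f. \<forall>\<^sub>F p in nhds 0. \<forall>\<sigma>\<in>ball 0 \<delta>. p = (\<sigma> ^ m, y \<sigma>) \<longrightarrow>
    germ_eval f p = \<sigma> ^ n * (\<Prod>\<zeta>\<in>{\<zeta>. \<zeta> ^ m = 1} - {1}. y \<sigma> - y (\<zeta> * \<sigma>))"
proof -
  define \<mu> where "\<mu> = {\<zeta> :: complex. \<zeta> ^ m = 1}"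
  have fin: "finite \<mu>" unfolding \<mu>_def using m by (intro finite_nth_roots) auto
  have \<mu>1: "1 \<in> \<mu>" by (simp add: \<mu>_def)
  have norm1: "norm \<zeta> = 1" if "\<zeta> \<in> \<mu>" for \<zeta>
  proof -
    have "norm \<zeta> ^ m = 1 ^ m" using that by (simp add: \<mu>_def flip: norm_power)
    then show ?thesis by (rule power_eq_imp_eq_base) (use m in auto)
  qed
  define L where "L \<zeta> \<sigma> = (\<Prod>\<xi>\<in>\<mu> - {\<zeta>}. [:- y (\<xi> * \<sigma>), 1:])" for \<zeta> \<sigma>
  define p where "p \<sigma> = (\<Sum>\<zeta>\<in>\<mu>. smult ((\<zeta> * \<sigma>) ^ n) (L \<zeta> \<sigma>))" for \<sigma>
  have holy: "(\<lambda>\<sigma>. y (\<xi> * \<sigma>)) holomorphic_on ball 0 \<delta>" if "\<xi> \<in> \<mu>" for \<xi>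
  proof -
    have "(y \<circ> (\<lambda>\<sigma>. \<xi> * \<sigma>)) holomorphic_on ball 0 \<delta>"
      by (rule holomorphic_on_compose_gen[OF _ hol]) (use norm1[OF that] in \<open>auto intro!: holomorphic_intros simp: norm_mult\<close>)
    then show ?thesis by (simp add: o_def)
  qed
  have holp: "(\<lambda>\<sigma>. coeff (p \<sigma>) j) holomorphic_on ball 0 \<delta>" for j
    unfolding p_def L_def coeff_sum coeff_smult
    by (intro holomorphic_intros holomorphic_coeff_linear_factors[where a = "\<lambda>\<xi> \<sigma>. y (\<xi> * \<sigma>)"]) (use holy in auto)
  have deg: "degree (p \<sigma>) \<le> card \<mu>" for \<sigma>
  proof -
    have "degree (L \<zeta> \<sigma>) \<le> card \<mu>" for \<zeta>
    proof -
      have "degree (L \<zeta> \<sigma>) \<le> (\<Sum>\<xi>\<in>\<mu> - {\<zeta>}. degree [:- y (\<xi> * \<sigma>), 1:])"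
        unfolding L_def using fin degree_prod_sum_le[of "\<mu> - {\<zeta>}" "\<lambda>\<xi>. [:- y (\<xi> * \<sigma>), 1:]"] by (simp add: o_def)
      also have "\<dots> \<le> card \<mu>" using fin by (simp add: card_Diff_subset_Int card_mono)
      finally show ?thesis .
    qed
    then show ?thesis unfolding p_def
      by (intro degree_sum_le fin) (meson degree_smult_le order_trans)
  qed
  have inv: "p (\<omega> * \<sigma>) = p \<sigma>" if \<omega>: "\<omega> \<in> \<mu>" for \<omega> \<sigma>
  proof -
    have \<omega>0: "\<omega> \<noteq> 0" using norm1[OF \<omega>] by auto
    have bij: "bij_betw (\<lambda>\<xi>. \<xi> * \<omega>) \<mu> \<mu>"
      using \<omega> \<omega>0 by (intro bij_betwI[where g = "\<lambda>\<xi>. \<xi> / \<omega>"]) (auto simp: \<mu>_def power_mult_distrib power_divide)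
    have L: "L \<zeta> (\<omega> * \<sigma>) = L (\<zeta> * \<omega>) \<sigma>" if "\<zeta> \<in> \<mu>" for \<zeta>
    proof -
      have "bij_betw (\<lambda>\<xi>. \<xi> * \<omega>) (\<mu> - {\<zeta>}) (\<mu> - {\<zeta> * \<omega>})"
        using bij_betw_DiffI[OF bij, of "{\<zeta>}" "{\<zeta> * \<omega>}"] that bij by (auto simp: bij_betw_def)
      from prod.reindex_bij_betw[OF this, of "\<lambda>\<xi>. [:- y (\<xi> * \<sigma>), 1:]"] show ?thesis
        by (simp add: L_def mult.assoc)
    qed
    have "p (\<omega> * \<sigma>) = (\<Sum>\<zeta>\<in>\<mu>. smult ((\<zeta> * \<omega> * \<sigma>) ^ n) (L (\<zeta> * \<omega>) \<sigma>))"
      unfolding p_def by (intro sum.cong) (simp_all add: L mult.assoc)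
    also have "\<dots> = p \<sigma>"
      unfolding p_def by (rule sum.reindex_bij_betw[OF bij, of "\<lambda>\<zeta>. smult ((\<zeta> * \<sigma>) ^ n) (L \<zeta> \<sigma>)"])
    finally show ?thesis .
  qed
  have "\<exists>d. fps_conv_radius d > 0 \<and> (\<forall>\<sigma>\<in>ball 0 \<delta>. eval_fps d (\<sigma> ^ m) = coeff (p \<sigma>) j)" for j
    by (rule root_unity_invariant_imp_power[OF m \<delta> holp]) (simp add: inv \<mu>_def)
  then obtain d where d: "\<And>j. fps_conv_radius (d j) > 0" "\<And>j \<sigma>. \<sigma> \<in> ball 0 \<delta> \<Longrightarrow> eval_fps (d j) (\<sigma> ^ m) = coeff (p \<sigma>) j"
    by metis
  obtain f where f: "\<forall>\<^sub>F p in nhds 0. germ_eval f p = (\<Sum>j<Suc (card \<mu>). eval_fps (d j) (fst p) * snd p ^ j)"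
    using ex_germ_polynomial[of d "Suc (card \<mu>)", OF d(1)] by blast
  have val: "poly (p \<sigma>) (y \<sigma>) = \<sigma> ^ n * (\<Prod>\<zeta>\<in>\<mu> - {1}. y \<sigma> - y (\<zeta> * \<sigma>))" for \<sigma>
  proof -
    have "poly (L \<zeta> \<sigma>) (y \<sigma>) = 0" if "\<zeta> \<in> \<mu> - {1}" for \<zeta>
      unfolding L_def poly_prod using fin \<mu>1 that by (intro prod_zero bexI[of _ 1]) auto
    then have "poly (p \<sigma>) (y \<sigma>) = poly (smult ((1 * \<sigma>) ^ n) (L 1 \<sigma>)) (y \<sigma>)"
      unfolding p_def poly_sum by (subst sum.remove[OF fin \<mu>1]) (simp add: sum.neutral)
    then show ?thesis by (simp add: L_def poly_prod)
  qed
  show ?thesis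
    using f
  proof (intro exI, eventually_elim, intro ballI impI)
    fix q \<sigma> assume f: "germ_eval f q = (\<Sum>j<Suc (card \<mu>). eval_fps (d j) (fst q) * snd q ^ j)"
      and \<sigma>: "\<sigma> \<in> ball 0 \<delta>" and q: "q = (\<sigma> ^ m, y \<sigma>)"
    have "germ_eval f q = (\<Sum>j\<le>card \<mu>. coeff (p \<sigma>) j * y \<sigma> ^ j)"
      using f d(2)[OF \<sigma>] by (simp add: q lessThan_Suc_atMost)
    also have "\<dots> = poly (p \<sigma>) (y \<sigma>)"
      unfolding poly_altdef using deg[of \<sigma>]
      by (intro sum.mono_neutral_right) (auto simp: coeff_eq_0)
    finally show "germ_eval f q = \<sigma> ^ n * (\<Prod>\<zeta>\<in>{\<zeta>. \<zeta> ^ m = 1} - {1}. y \<sigma> - y (\<zeta> * \<sigma>))"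
      by (simp add: val \<mu>_def)
  qed
qed

section \<open>Large orders on a branch\<close>

text \<open>
  A holomorphic \<open>m\<close>-th root \<open>s\<close> of the first coordinate, \<open>m\<close> being its order of vanishing, is a new
  local parameter. The last property is the injectivity of the uniformization in this parameter.
\<close>
lemma ramified_normal_form:
  assumes uni: "uniformization \<gamma> S" and nz: "\<not> (\<forall>\<^sub>F t in nhds 0. fst (\<gamma> t) = 0)"
  obtains m \<delta> s y where "m > 0" "\<delta> > 0" "s analytic_on {0}" "s 0 = 0" "deriv s 0 \<noteq> 0"
    "y holomorphic_on ball 0 \<delta>" "\<forall>\<^sub>F t in nhds 0. s t \<in> ball 0 \<delta> \<and> \<gamma> t = (s t ^ m, y (s t))"
    "\<And>\<sigma> \<sigma>'. \<sigma> \<in> ball 0 \<delta> \<Longrightarrow> \<sigma>' \<in> ball 0 \<delta> \<Longrightarrow> \<sigma> ^ m = \<sigma>' ^ m \<Longrightarrow> y \<sigma> = y \<sigma>' \<Longrightarrow> \<sigma> = \<sigma>'"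
proof -
  let ?x = "\<lambda>t. fst (\<gamma> t)"
  obtain \<epsilon> where \<epsilon>: "\<epsilon> > 0" and holx: "?x holomorphic_on ball 0 \<epsilon>" and holy: "(\<lambda>t. snd (\<gamma> t)) holomorphic_on ball 0 \<epsilon>"
    and inj: "inj_on \<gamma> (ball 0 \<epsilon>)" and \<gamma>0: "\<gamma> 0 = 0"
    using uni by (auto simp: uniformization_def)
  define X where "X = fps_expansion ?x 0"
  have X: "?x has_fps_expansion X"
    unfolding X_def using holx \<epsilon> by (intro analytic_at_imp_has_fps_expansion_0) (auto simp: analytic_on_def)
  have Xnz: "X \<noteq> 0" using X nz by (metis has_fps_expansion_0_iff)
  have X0: "X $ 0 = 0" using fps_nth_fps_expansion[OF X, of 0] \<gamma>0 by simp
  define m where "m = subdegree X"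
  have m: "m > 0" using Xnz X0 nth_subdegree_nonzero[OF Xnz] unfolding m_def by (metis gr0I)
  have derivs: "(deriv ^^ i) ?x 0 = X $ i * fact i" for i
    using fps_nth_fps_expansion[OF X, of i] by simp
  obtain g r where r: "0 < r" and holg: "g holomorphic_on ball 0 r"
    and xg: "\<And>w. w \<in> ball 0 r \<Longrightarrow> ?x w = (w * g w) ^ m" and g0: "\<And>w. w \<in> ball 0 r \<Longrightarrow> g w \<noteq> 0"
  proof -
    have "X $ m \<noteq> 0" using Xnz by (simp add: m_def)
    then have top: "(deriv ^^ m) ?x 0 \<noteq> 0" unfolding derivs by simp
    have low: "(deriv ^^ i) ?x 0 = 0" if "0 < i" "i < m" for i
    proof -
      have "X $ i = 0" using that(2) unfolding m_def by (rule nth_less_subdegree_zero)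
      then show ?thesis by (simp only: derivs mult_zero_left)
    qed
    have "(0 :: complex) \<in> ball 0 \<epsilon>" using \<epsilon> by simp
    then show thesis
    proof (rule holomorphic_factor_order_of_zero_strong[OF holx open_ball _ m top low])
      fix g r
      assume *: "0 < r" "g holomorphic_on ball 0 r" "\<And>w. w \<in> ball 0 r \<Longrightarrow> ?x w - ?x 0 = ((w - 0) * g w) ^ m"
        "\<And>w. w \<in> ball 0 r \<Longrightarrow> g w \<noteq> 0"
      have "?x w = (w * g w) ^ m" if "w \<in> ball 0 r" for w
        using *(3)[OF that] \<gamma>0 by simp
      from that[OF *(1,2) this *(4)] show thesis .
    qed
  qed
  define s where "s = (\<lambda>w. w * g w)"
  have hols: "s holomorphic_on ball 0 r"
    unfolding s_def using holg by (intro holomorphic_intros)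
  have s0: "s 0 = 0" by (simp add: s_def)
  have "(g has_field_derivative deriv g 0) (at 0)"
    using holg r by (intro holomorphic_derivI) auto
  then have "(s has_field_derivative (1 * g 0 + deriv g 0 * 0)) (at 0)"
    unfolding s_def by (intro DERIV_mult DERIV_ident)
  then have ds: "deriv s 0 \<noteq> 0" using g0[of 0] r by (simp add: DERIV_imp_deriv)
  obtain r1 where r1: "r1 > 0" "ball (0 :: complex) r1 \<subseteq> ball 0 r" "inj_on s (ball 0 r1)"
  proof (rule has_complex_derivative_locally_injective[OF hols _ open_ball ds])
    show "0 \<in> ball 0 r" using r by simp
  qed (rule that)
  define r2 where "r2 = min r1 \<epsilon>"
  have r2: "r2 > 0" "ball (0 :: complex) r2 \<subseteq> ball 0 r" "ball (0 :: complex) r2 \<subseteq> ball 0 \<epsilon>" "inj_on s (ball 0 r2)"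
    using r1 \<epsilon> by (auto simp: r2_def intro: inj_on_subset)
  have hols2: "s holomorphic_on ball 0 r2" using hols r2(2) by (rule holomorphic_on_subset)
  obtain \<theta> where \<theta>: "\<theta> holomorphic_on (s ` ball 0 r2)" "\<And>z. z \<in> ball 0 r2 \<Longrightarrow> \<theta> (s z) = z"
    by (rule holomorphic_has_inverse[OF hols2 open_ball r2(4)]) blast
  have "open (s ` ball 0 r2)" by (rule open_mapping_thm3[OF hols2 open_ball r2(4)])
  moreover have "0 \<in> s ` ball 0 r2" using r2(1) s0 by force
  ultimately obtain \<delta> where \<delta>: "\<delta> > 0" "ball 0 \<delta> \<subseteq> s ` ball 0 r2" by (meson open_contains_ball)
  have inv: "\<theta> \<sigma> \<in> ball 0 r2 \<and> s (\<theta> \<sigma>) = \<sigma>" if "\<sigma> \<in> ball 0 \<delta>" for \<sigma>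
    using \<theta>(2) \<delta>(2) that by force
  define y where "y = (\<lambda>\<sigma>. snd (\<gamma> (\<theta> \<sigma>)))"
  have par: "\<gamma> t = (s t ^ m, y (s t))" if "t \<in> ball 0 r2" for t
    using xg[of t] that r2(2) \<theta>(2) by (auto simp: y_def s_def prod_eq_iff)
  show thesis
  proof
    show "m > 0" "\<delta> > 0" "s 0 = 0" "deriv s 0 \<noteq> 0" by fact+
    show "s analytic_on {0}" using hols r by (auto simp: analytic_on_def)
    have "((\<lambda>t. snd (\<gamma> t)) \<circ> \<theta>) holomorphic_on ball 0 \<delta>"
      by (rule holomorphic_on_compose_gen[OF holomorphic_on_subset[OF \<theta>(1) \<delta>(2)] holy])
        (use inv r2(3) in blast)
    then show "y holomorphic_on ball 0 \<delta>" by (simp add: y_def o_def)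
    have "isCont s 0" using hols r by (metis analytic_at analytic_at_imp_isCont centre_in_ball open_ball)
    then have "(s \<longlongrightarrow> 0) (nhds 0)" using s0 by (simp add: continuous_at tendsto_nhds_iff)
    then have "\<forall>\<^sub>F t in nhds 0. s t \<in> ball 0 \<delta>"
      using \<delta>(1) by (intro topological_tendstoD) auto
    moreover have "\<forall>\<^sub>F t in nhds (0 :: complex). t \<in> ball 0 r2"
      using r2(1) by (intro eventually_nhds_in_open) auto
    ultimately show "\<forall>\<^sub>F t in nhds 0. s t \<in> ball 0 \<delta> \<and> \<gamma> t = (s t ^ m, y (s t))"
      by eventually_elim (use par in blast)
  next
    fix \<sigma> \<sigma>' assume *: "\<sigma> \<in> ball 0 \<delta>" "\<sigma>' \<in> ball 0 \<delta>" "\<sigma> ^ m = \<sigma>' ^ m" "y \<sigma> = y \<sigma>'"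
    then have "\<gamma> (\<theta> \<sigma>) = \<gamma> (\<theta> \<sigma>')" using par[of "\<theta> \<sigma>"] par[of "\<theta> \<sigma>'"] inv by metis
    then have "\<theta> \<sigma> = \<theta> \<sigma>'" using inv *(1,2) r2(3) inj by (meson inj_onD subsetD)
    then show "\<sigma> = \<sigma>'" using inv *(1,2) by metis
  qed
qed

text \<open>
  In the parameter of the normal form, \<open>lagrange_germ\<close> realizes \<open>s^n D(s)\<close> for every \<open>n\<close>, of order
  \<open>n\<close> plus the order of \<open>D(s)\<close>; a zero of \<open>D\<close> close to the origin but different from it would give
  two parameters with the same image. If the first coordinate vanishes identically, the second one is itself injective and
  its powers have all orders.
\<close>
lemma ex_conductor:
  assumes uni: "uniformization \<gamma> S"
  shows "\<exists>c. \<forall>n\<ge>c. \<exists>f. pullback \<gamma> f \<noteq> 0 \<and> subdegree (pullback \<gamma> f) = n"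
proof -
  have par: "germ_arc \<gamma>" using uni by (rule uniformization_germ_arc)
  note tend = germ_arc_tendsto[OF par]
  show ?thesis
  proof (cases "\<forall>\<^sub>F t in nhds 0. fst (\<gamma> t) = 0")
    case True
    obtain \<epsilon> where \<epsilon>: "\<epsilon> > 0" and holy: "(\<lambda>t. snd (\<gamma> t)) holomorphic_on ball 0 \<epsilon>"
      and inj: "inj_on \<gamma> (ball 0 \<epsilon>)" and \<gamma>0: "\<gamma> 0 = 0"
      using uni by (auto simp: uniformization_def)
    obtain e where e: "e > 0" "\<And>t. t \<in> ball 0 e \<Longrightarrow> fst (\<gamma> t) = 0"
      using True unfolding eventually_nhds_metric by (auto simp: dist_commute)
    define e' where "e' = min e \<epsilon>"
    have e': "e' > 0" using e \<epsilon> by (simp add: e'_def)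
    have injy: "inj_on (\<lambda>t. snd (\<gamma> t)) (ball 0 e')"
    proof (rule inj_onI)
      fix t t' assume *: "t \<in> ball 0 e'" "t' \<in> ball 0 e'" "snd (\<gamma> t) = snd (\<gamma> t')"
      then have "\<gamma> t = \<gamma> t'" using e by (simp add: prod_eq_iff e'_def)
      then show "t = t'" using inj * by (auto simp: e'_def dest: inj_onD)
    qed
    have "(\<lambda>t. snd (\<gamma> t)) holomorphic_on ball 0 e'"
      using holy by (rule holomorphic_on_subset) (auto simp: e'_def)
    from holomorphic_injective_imp_regular[OF this open_ball injy] e'
    have dy: "deriv (\<lambda>t. snd (\<gamma> t)) 0 \<noteq> 0" by simp
    define Y where "Y = fps_expansion (\<lambda>t. snd (\<gamma> t)) 0"
    have Y: "(\<lambda>t. snd (\<gamma> t)) has_fps_expansion Y"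
      unfolding Y_def using par by (intro analytic_at_imp_has_fps_expansion_0) (simp add: germ_arc_def)
    have "Y $ 0 = 0" "Y $ 1 \<noteq> 0"
      using fps_nth_fps_expansion[OF Y] dy \<gamma>0 by simp_all
    then have Y1: "subdegree Y = 1" by (intro subdegreeI) auto
    obtain f where "\<forall>\<^sub>F p in nhds 0. germ_eval f p = snd p" using ex_germ_snd by blast
    then have f: "pullback \<gamma> f = Y"
      using pullback_eqI[OF par _ Y] eventually_compose_filterlim[OF _ tend] by blast
    have "pullback \<gamma> (f ^ n) = Y ^ n" for n
    proof (induction n)
      case 0
      show ?case using pullback_const[OF par, of 1] by (simp add: const_germ_simps)
    qed (simp add: pullback_mult[OF par] f)
    then have "subdegree (pullback \<gamma> (f ^ n)) = n \<and> pullback \<gamma> (f ^ n) \<noteq> 0" for n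
      using Y1 \<open>Y $ 1 \<noteq> 0\<close> by auto
    then show ?thesis by blast
  next
    case False
    obtain m \<delta> s y where m: "m > 0" and \<delta>: "\<delta> > 0" and s: "s analytic_on {0}" "s 0 = 0" "deriv s 0 \<noteq> 0"
      and y: "y holomorphic_on ball 0 \<delta>"
      and ev: "\<forall>\<^sub>F t in nhds 0. s t \<in> ball 0 \<delta> \<and> \<gamma> t = (s t ^ m, y (s t))"
      and inj: "\<And>\<sigma> \<sigma>'. \<sigma> \<in> ball 0 \<delta> \<Longrightarrow> \<sigma>' \<in> ball 0 \<delta> \<Longrightarrow> \<sigma> ^ m = \<sigma>' ^ m \<Longrightarrow> y \<sigma> = y \<sigma>' \<Longrightarrow> \<sigma> = \<sigma>'"
      using ramified_normal_form[OF uni False] by blast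
    let ?\<mu> = "{\<zeta> :: complex. \<zeta> ^ m = 1} - {1}"
    have fin: "finite ?\<mu>" using m by (intro finite_Diff finite_nth_roots) auto
    have norm1: "norm \<zeta> = 1" if "\<zeta> \<in> ?\<mu>" for \<zeta>
    proof -
      have "norm \<zeta> ^ m = 1 ^ m" using that by (simp flip: norm_power)
      then show ?thesis by (rule power_eq_imp_eq_base) (use m in auto)
    qed
    define D where "D = (\<lambda>\<sigma>. \<Prod>\<zeta>\<in>?\<mu>. y \<sigma> - y (\<zeta> * \<sigma>))"
    have "(\<lambda>\<sigma>. y (\<zeta> * \<sigma>)) holomorphic_on ball 0 \<delta>" if "\<zeta> \<in> ?\<mu>" for \<zeta>
    proof -
      have "(y \<circ> (\<lambda>\<sigma>. \<zeta> * \<sigma>)) holomorphic_on ball 0 \<delta>"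
        by (rule holomorphic_on_compose_gen[OF _ y]) (use norm1[OF that] in \<open>auto intro!: holomorphic_intros simp: norm_mult\<close>)
      then show ?thesis by (simp add: o_def)
    qed
    then have "D holomorphic_on ball 0 \<delta>"
      unfolding D_def using y by (intro holomorphic_intros)
    then have "D analytic_on {0}" using \<delta> by (auto simp: analytic_on_def)
    then have "(D \<circ> s) analytic_on {0}"
      using s by (intro analytic_on_compose_gen[OF s(1), where T = "{0}"]) auto
    then have "(\<lambda>t. D (s t)) has_fps_expansion fps_expansion (\<lambda>t. D (s t)) 0"
      by (intro analytic_at_imp_has_fps_expansion_0) (simp add: o_def)
    then obtain E where E: "(\<lambda>t. D (s t)) has_fps_expansion E" by blast
    define Sx where "Sx = fps_expansion s 0"
    have Sx: "s has_fps_expansion Sx" unfolding Sx_def using s by (intro analytic_at_imp_has_fps_expansion_0)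
    have "Sx $ 0 = 0" "Sx $ 1 \<noteq> 0" using fps_nth_fps_expansion[OF Sx] s by simp_all
    then have Sx1: "subdegree Sx = 1" by (intro subdegreeI) auto
    have Sxnz: "Sx \<noteq> 0" using \<open>Sx $ 1 \<noteq> 0\<close> by auto
    have Enz: "E \<noteq> 0"
    proof
      assume "E = 0"
      with E have "(\<lambda>t. D (s t)) has_fps_expansion 0" by simp
      then have "\<forall>\<^sub>F t in nhds 0. D (s t) = 0" by (rule iffD1[OF has_fps_expansion_0_iff])
      with ev have "\<forall>\<^sub>F t in nhds 0. s t = 0"
      proof eventually_elim
        case (elim t)
        then obtain \<zeta> where \<zeta>: "\<zeta> \<in> ?\<mu>" "y (s t) = y (\<zeta> * s t)"
          using fin by (auto simp: D_def)
        have "s t = \<zeta> * s t"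
          by (rule inj) (use elim \<zeta> norm1[OF \<zeta>(1)] in \<open>auto simp: norm_mult power_mult_distrib\<close>)
        with \<zeta> show ?case by auto
      qed
      then have "s has_fps_expansion 0" by (rule iffD2[OF has_fps_expansion_0_iff])
      with Sx have "Sx = 0" by (rule fps_expansion_unique_complex)
      with Sxnz show False by simp
    qed
    have "\<exists>f. pullback \<gamma> f = Sx ^ n * E" for n
    proof -
      obtain f where f: "\<forall>\<^sub>F p in nhds 0. \<forall>\<sigma>\<in>ball 0 \<delta>. p = (\<sigma> ^ m, y \<sigma>) \<longrightarrow> germ_eval f p = \<sigma> ^ n * D \<sigma>"
        unfolding D_def using lagrange_germ[OF m \<delta> y] by blast
      have "\<forall>\<^sub>F t in nhds 0. germ_eval f (\<gamma> t) = s t ^ n * D (s t)"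
        using eventually_compose_filterlim[OF f tend] ev by eventually_elim blast
      moreover have "(\<lambda>t. s t ^ n * D (s t)) has_fps_expansion Sx ^ n * E"
        by (intro fps_expansion_intros Sx E)
      ultimately have "pullback \<gamma> f = Sx ^ n * E" by (rule pullback_eqI[OF par])
      then show ?thesis by blast
    qed
    moreover have "subdegree (Sx ^ n * E) = n + subdegree E \<and> Sx ^ n * E \<noteq> 0" for n
      using Sxnz Enz Sx1 by simp
    ultimately have "\<exists>f. pullback \<gamma> f \<noteq> 0 \<and> subdegree (pullback \<gamma> f) = n" if "n \<ge> subdegree E" for n
      using that by (metis le_add_diff_inverse2)
    then show ?thesis by blast
  qed
qed

section \<open>Separation of distinct branches\<close>
lemma uniformization_continuous_inj:
  assumes "uniformization \<gamma> S"
  obtains \<epsilon> where "\<epsilon> > 0" "continuous_on (ball 0 \<epsilon>) \<gamma>" "inj_on \<gamma> (ball 0 \<epsilon>)"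
proof -
  obtain \<epsilon> where \<epsilon>: "\<epsilon> > 0" "(\<lambda>t. fst (\<gamma> t)) holomorphic_on ball 0 \<epsilon>" "(\<lambda>t. snd (\<gamma> t)) holomorphic_on ball 0 \<epsilon>"
    "inj_on \<gamma> (ball 0 \<epsilon>)"
    using assms by (auto simp: uniformization_def)
  then have "continuous_on (ball 0 \<epsilon>) (\<lambda>t. (fst (\<gamma> t), snd (\<gamma> t)))"
    by (intro continuous_on_Pair holomorphic_on_imp_continuous_on)
  with \<epsilon> that show thesis by simp
qed

lemma uniformization_image:
  assumes "uniformization \<gamma> S" "e > 0"
  obtains d where "0 < d" "d < e" "same_germ (\<gamma> ` ball 0 d) S"
proof -
  have "\<forall>\<^sub>F d in at_right 0. same_germ (\<gamma> ` ball 0 d) S" using assms by (simp add: uniformization_def)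
  moreover have "\<forall>\<^sub>F d in at_right 0. d \<in> {0<..<e}" using assms(2) by (rule eventually_at_right_real)
  ultimately have "\<forall>\<^sub>F d in at_right 0. same_germ (\<gamma> ` ball 0 d) S \<and> d \<in> {0<..<e}" by (rule eventually_conj)
  then have "\<exists>d. same_germ (\<gamma> ` ball 0 d) S \<and> d \<in> {0<..<e}"
    by (rule eventually_happens'[rotated]) simp
  with that show thesis by auto
qed

text \<open>
  The continuous injective map \<open>\<tau> = \<gamma>1\<^sup>-\<^sup>1 \<circ> \<gamma>2\<close> between discs is open by invariance of domain, so the
  image of \<open>\<gamma>2\<close> contains the image under \<open>\<gamma>1\<close> of a neighbourhood of the origin. This replaces an
  appeal to the Nullstellensatz for the equations of the two branches.
\<close>
lemma uniformization_contained_imp_same_germ: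
  assumes u1: "uniformization \<gamma>1 S1" and u2: "uniformization \<gamma>2 S2"
    and sub: "\<forall>\<^sub>F t in nhds 0. \<gamma>2 t \<in> S1"
  shows "same_germ S1 S2"
proof -
  obtain \<epsilon>1 where \<epsilon>1: "\<epsilon>1 > 0" "continuous_on (ball 0 \<epsilon>1) \<gamma>1" "inj_on \<gamma>1 (ball 0 \<epsilon>1)"
    using uniformization_continuous_inj[OF u1] .
  obtain \<epsilon>2 where \<epsilon>2: "\<epsilon>2 > 0" "continuous_on (ball 0 \<epsilon>2) \<gamma>2" "inj_on \<gamma>2 (ball 0 \<epsilon>2)"
    using uniformization_continuous_inj[OF u2] .
  have \<gamma>0: "\<gamma>1 0 = 0" "\<gamma>2 0 = 0" using u1 u2 by (auto simp: uniformization_def)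
  obtain d where d: "0 < d" "d < \<epsilon>1" "same_germ (\<gamma>1 ` ball 0 d) S1"
    using uniformization_image[OF u1 \<epsilon>1(1)] .
  have "\<forall>\<^sub>F t in nhds 0. \<gamma>2 t \<in> \<gamma>1 ` ball 0 d \<longleftrightarrow> \<gamma>2 t \<in> S1"
    using eventually_compose_filterlim[OF d(3)[unfolded same_germ_def] germ_arc_tendsto[OF uniformization_germ_arc[OF u2]]] .
  with sub have "\<forall>\<^sub>F t in nhds 0. \<gamma>2 t \<in> \<gamma>1 ` ball 0 d" by eventually_elim blast
  then obtain e where e: "e > 0" "\<And>t. t \<in> ball 0 e \<Longrightarrow> \<gamma>2 t \<in> \<gamma>1 ` ball 0 d"
    unfolding eventually_nhds_metric by (auto simp: dist_commute)
  obtain \<eta> where \<eta>: "0 < \<eta>" "\<eta> < min e \<epsilon>2" "same_germ (\<gamma>2 ` ball 0 \<eta>) S2"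
    using uniformization_image[OF u2, of "min e \<epsilon>2"] e \<epsilon>2 by auto
  define \<kappa> where "\<kappa> = inv_into (cball 0 d) \<gamma>1"
  have cball: "cball 0 d \<subseteq> ball 0 \<epsilon>1" using d by auto
  have inj1: "inj_on \<gamma>1 (cball 0 d)" using \<epsilon>1(3) cball by (rule inj_on_subset)
  have \<kappa>: "\<kappa> (\<gamma>1 t) = t" if "t \<in> cball 0 d" for t
    unfolding \<kappa>_def using inj1 that by (rule inv_into_f_f)
  have contk: "continuous_on (\<gamma>1 ` cball 0 d) \<kappa>"
    by (rule continuous_on_inv[OF continuous_on_subset[OF \<epsilon>1(2) cball]]) (auto simp: \<kappa>)
  define \<tau> where "\<tau> = \<kappa> \<circ> \<gamma>2"
  have \<tau>: "\<tau> t \<in> ball 0 d \<and> \<gamma>1 (\<tau> t) = \<gamma>2 t" if "t \<in> ball 0 \<eta>" for t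
  proof -
    have "t \<in> ball 0 e" using that \<eta> by auto
    then obtain u where "u \<in> ball 0 d" "\<gamma>2 t = \<gamma>1 u" using e(2) by blast
    then show ?thesis using \<kappa>[of u] by (simp add: \<tau>_def)
  qed
  have "continuous_on (ball 0 \<eta>) \<tau>"
    unfolding \<tau>_def
  proof (rule continuous_on_compose)
    show "continuous_on (ball 0 \<eta>) \<gamma>2" using \<epsilon>2(2) by (rule continuous_on_subset) (use \<eta> in auto)
    show "continuous_on (\<gamma>2 ` ball 0 \<eta>) \<kappa>"
      using contk by (rule continuous_on_subset) (use e(2) \<eta> in force)
  qed
  moreover have "inj_on \<tau> (ball 0 \<eta>)"
  proof (rule inj_onI)
    fix t t' assume *: "t \<in> ball 0 \<eta>" "t' \<in> ball 0 \<eta>" "\<tau> t = \<tau> t'"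
    then have "\<gamma>2 t = \<gamma>2 t'" using \<tau> by metis
    then show "t = t'" using \<epsilon>2(3) * \<eta> by (auto dest: inj_onD)
  qed
  ultimately have "open (\<tau> ` ball 0 \<eta>)" by (intro invariance_of_domain) auto
  moreover have "0 \<in> \<tau> ` ball 0 \<eta>"
  proof -
    have "\<tau> 0 = 0" using \<kappa>[of 0] d \<gamma>0 by (simp add: \<tau>_def)
    then show ?thesis using \<eta>(1) by force
  qed
  ultimately obtain d' where d': "d' > 0" "ball 0 d' \<subseteq> \<tau> ` ball 0 \<eta>" by (meson open_contains_ball)
  obtain d'' where d'': "0 < d''" "d'' < d'" "same_germ (\<gamma>1 ` ball 0 d'') S1"
    using uniformization_image[OF u1 d'(1)] .
  \<comment> \<open>The image of the second uniformization lies between two images of discs under the first.\<close>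
  have sub1: "\<gamma>1 ` ball 0 d'' \<subseteq> \<gamma>2 ` ball 0 \<eta>"
  proof
    fix p assume "p \<in> \<gamma>1 ` ball 0 d''"
    then obtain u where u: "u \<in> ball 0 d''" "p = \<gamma>1 u" by blast
    then obtain t where "t \<in> ball 0 \<eta>" "u = \<tau> t" using d'(2) d''(2) by force
    then show "p \<in> \<gamma>2 ` ball 0 \<eta>" using u \<tau> by auto
  qed
  have sub2: "\<gamma>2 ` ball 0 \<eta> \<subseteq> \<gamma>1 ` ball 0 d" using \<tau> by force
  show "same_germ S1 S2"
    using d(3) d''(3) \<eta>(3) unfolding same_germ_def
    by eventually_elim (use sub1 sub2 in blast)
qed

lemma uniformization_eventually_in:
  assumes "uniformization \<gamma> S"
  shows "\<forall>\<^sub>F t in nhds 0. \<gamma> t \<in> S"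
proof -
  obtain d where d: "0 < d" "same_germ (\<gamma> ` ball 0 d) S"
    using uniformization_image[OF assms zero_less_one] by blast
  have "\<forall>\<^sub>F t in nhds 0. t \<in> ball 0 d" using d by (intro eventually_nhds_in_open) auto
  moreover have "\<forall>\<^sub>F t in nhds 0. \<gamma> t \<in> \<gamma> ` ball 0 d \<longleftrightarrow> \<gamma> t \<in> S"
    using eventually_compose_filterlim[OF d(2)[unfolded same_germ_def] germ_arc_tendsto[OF uniformization_germ_arc[OF assms]]] .
  ultimately show ?thesis by eventually_elim blast
qed

lemma irreducible_curve_equation:
  assumes "irreducible_curve S1"
  obtains f where "\<And>\<gamma> S. uniformization \<gamma> S \<Longrightarrow> pullback \<gamma> f = 0 \<longleftrightarrow> (\<forall>\<^sub>F t in nhds 0. \<gamma> t \<in> S1)"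
proof -
  obtain f where f: "same_germ S1 {p. germ_eval f p = 0}"
    using assms by (auto simp: irreducible_curve_def)
  show thesis
  proof (rule that)
    fix \<gamma> S assume u: "uniformization \<gamma> S"
    note par = uniformization_germ_arc[OF u]
    have "\<forall>\<^sub>F t in nhds 0. \<gamma> t \<in> S1 \<longleftrightarrow> germ_eval f (\<gamma> t) = 0"
      using eventually_compose_filterlim[OF f[unfolded same_germ_def] germ_arc_tendsto[OF par]] by simp
    then show "pullback \<gamma> f = 0 \<longleftrightarrow> (\<forall>\<^sub>F t in nhds 0. \<gamma> t \<in> S1)"
      unfolding pullback_eq_0_iff[OF par] by (rule eventually_subst[symmetric])
  qed
qed

lemma ex_separating_germ:
  assumes red: "reduced_curve r B" and uni: "\<And>k. k \<in> {1..r} \<Longrightarrow> uniformization (\<gamma> k) (B k)"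
    and k: "k \<in> {1..r}"
  shows "\<exists>g. pullback (\<gamma> k) g \<noteq> 0 \<and> (\<forall>j\<in>{1..r} - {k}. pullback (\<gamma> j) g = 0)"
proof -
  have "\<exists>f. pullback (\<gamma> k) f \<noteq> 0 \<and> pullback (\<gamma> j) f = 0" if j: "j \<in> {1..r} - {k}" for j
  proof -
    have "irreducible_curve (B j)" using red j by (auto simp: reduced_curve_def)
    then obtain f where f: "\<And>\<gamma> S. uniformization \<gamma> S \<Longrightarrow> pullback \<gamma> f = 0 \<longleftrightarrow> (\<forall>\<^sub>F t in nhds 0. \<gamma> t \<in> B j)"
      using irreducible_curve_equation by blast
    have "\<not> same_germ (B j) (B k)" using red j k by (auto simp: reduced_curve_def)
    then have "pullback (\<gamma> k) f \<noteq> 0"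
      using f[OF uni[OF k]] uniformization_contained_imp_same_germ[OF uni uni[OF k]] j by blast
    moreover have "pullback (\<gamma> j) f = 0"
      using f[OF uni] uniformization_eventually_in[OF uni] j by blast
    ultimately show ?thesis by blast
  qed
  then obtain F where F: "\<And>j. j \<in> {1..r} - {k} \<Longrightarrow> pullback (\<gamma> k) (F j) \<noteq> 0 \<and> pullback (\<gamma> j) (F j) = 0"
    by metis
  have "\<exists>g. pullback (\<gamma> k) g \<noteq> 0 \<and> (\<forall>j\<in>K. pullback (\<gamma> j) g = 0)" if "finite K" "K \<subseteq> {1..r} - {k}" for K
    using that
  proof (induction K rule: finite_induct)
    case empty
    show ?case using pullback_const[OF uniformization_germ_arc[OF uni[OF k]], of 1] by (metis empty_iff fps_const_1_eq_1 zero_neq_one)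
  next
    case (insert j K)
    then obtain g where g: "pullback (\<gamma> k) g \<noteq> 0" "\<forall>j\<in>K. pullback (\<gamma> j) g = 0" by auto
    have par: "germ_arc (\<gamma> i)" if "i \<in> {1..r}" for i using uniformization_germ_arc[OF uni[OF that]] .
    have j: "j \<in> {1..r} - {k}" "\<And>i. i \<in> K \<Longrightarrow> i \<in> {1..r}" using insert by auto
    have "pullback (\<gamma> k) (F j * g) \<noteq> 0" using F[OF j(1)] g by (simp add: pullback_mult[OF par[OF k]])
    moreover have "\<forall>i\<in>insert j K. pullback (\<gamma> i) (F j * g) = 0"
      using F[OF j(1)] g j by (auto simp: pullback_mult[OF par])
    ultimately show ?case by blast
  qed
  from this[of "{1..r} - {k}"] show ?thesis by simp
qed

section \<open>Hilbert functions of plane curve germs\<close>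

text \<open>
  A germ \<open>a g\<close>, where \<open>g\<close> vanishes on the other branches and \<open>a\<close> has prescribed order on
  branch \<open>k\<close>, lies in the ideal of \<open>v\<close> whatever the other coordinates of \<open>v\<close> are. This is where the
  uniformity of the bound comes from.
\<close>
lemma ex_hilbert_fun:
  assumes red: "reduced_curve r B" and uni: "\<And>k. k \<in> {1..r} \<Longrightarrow> uniformization (\<gamma> k) (B k)"
  shows "\<exists>N. hilbert_fun r (hfun r \<gamma>) N"
proof -
  have par: "germ_arc (\<gamma> k)" if "k \<in> {1..r}" for k using uniformization_germ_arc[OF uni[OF that]] .
  interpret germ_filtration r "\<lambda>k. pullback (\<gamma> k)" "Jideal r \<gamma>"
    by (rule germ_filtration_Jideal) (rule par)
  have "\<exists>N. \<forall>n\<ge>N. \<exists>f. pullback (\<gamma> k) f \<noteq> 0 \<and> subdegree (pullback (\<gamma> k) f) = n \<and>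
      (\<forall>j\<in>{1..r} - {k}. pullback (\<gamma> j) f = 0)" if k: "k \<in> {1..r}" for k
  proof -
    obtain g where g: "pullback (\<gamma> k) g \<noteq> 0" "\<forall>j\<in>{1..r} - {k}. pullback (\<gamma> j) g = 0"
      using ex_separating_germ[OF red uni k] by blast
    obtain c where c: "\<And>n. n \<ge> c \<Longrightarrow> \<exists>a. pullback (\<gamma> k) a \<noteq> 0 \<and> subdegree (pullback (\<gamma> k) a) = n"
      using ex_conductor[OF uni[OF k]] by blast
    show ?thesis
    proof (intro exI[of _ "c + subdegree (pullback (\<gamma> k) g)"] allI impI)
      fix n assume n: "c + subdegree (pullback (\<gamma> k) g) \<le> n"
      then obtain a where a: "pullback (\<gamma> k) a \<noteq> 0" "subdegree (pullback (\<gamma> k) a) = n - subdegree (pullback (\<gamma> k) g)"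
        using c[of "n - subdegree (pullback (\<gamma> k) g)"] by (metis add_le_imp_le_diff)
      show "\<exists>f. pullback (\<gamma> k) f \<noteq> 0 \<and> subdegree (pullback (\<gamma> k) f) = n \<and> (\<forall>j\<in>{1..r} - {k}. pullback (\<gamma> j) f = 0)"
        using a g n by (intro exI[of _ "a * g"]) (auto simp: pullback_mult[OF par[OF k]] pullback_mult[OF par])
    qed
  qed
  then obtain N where N: "\<And>k n. k \<in> {1..r} \<Longrightarrow> n \<ge> N k \<Longrightarrow> \<exists>f. pullback (\<gamma> k) f \<noteq> 0 \<and>
      subdegree (pullback (\<gamma> k) f) = n \<and> (\<forall>j\<in>{1..r} - {k}. pullback (\<gamma> j) f = 0)"
    by metis
  have "hilbert_fun r (hfun r \<gamma>) N"
  proof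
    fix k and v :: "nat \<Rightarrow>\<^sub>0 int" assume k: "k \<in> {1..r}" "Poly_Mapping.lookup v k < 0"
    then show "hfun r \<gamma> (v + unit_vec k) = hfun r \<gamma> v" by (simp add: hfun_def J_shift(1))
  next
    fix k and v :: "nat \<Rightarrow>\<^sub>0 int" assume k: "k \<in> {1..r}" and large: "int (N k) \<le> Poly_Mapping.lookup v k"
    let ?n = "nat (Poly_Mapping.lookup v k)"
    have "N k \<le> ?n" using large by linarith
    then obtain f where f: "pullback (\<gamma> k) f \<noteq> 0" "subdegree (pullback (\<gamma> k) f) = ?n"
      "\<forall>j\<in>{1..r} - {k}. pullback (\<gamma> j) f = 0"
      using N[OF k] by blast
    have "pullback (\<gamma> j) f $ i = 0" if "j \<in> {1..r}" "i < nat (Poly_Mapping.lookup v j)" for j i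
      using f that by (cases "j = k") (auto intro: nth_less_subdegree_zero)
    then have "f \<in> Jideal r \<gamma> v" by (simp add: J_def)
    moreover have "pullback (\<gamma> k) f $ ?n \<noteq> 0" using f(1,2) by (metis nth_subdegree_nonzero)
    then have "f \<notin> Jideal r \<gamma> (v + unit_vec k)" using J_shift(2)[OF k, of v] large by simp
    ultimately show "hfun r \<gamma> (v + unit_vec k) = Suc (hfun r \<gamma> v)"
      unfolding hfun_def by (rule quot_dim_J_step[OF k])
  qed
  then show ?thesis by blast
qed

lemma hfun_0:
  assumes "\<And>k. k \<in> {1..r} \<Longrightarrow> germ_arc (\<gamma> k)"
  shows "hfun r \<gamma> 0 = 0"
  unfolding hfun_def by (rule germ_filtration.quot_dim_J_0[OF germ_filtration_Jideal[OF assms]])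

lemma hfun_forget:
  assumes "Poly_Mapping.keys v \<subseteq> {1..r}"
  shows "hfun (Suc r) (\<gamma>(Suc r := \<gamma>1)) v = hfun r \<gamma> v"
proof -
  have "Suc r \<notin> Poly_Mapping.keys v" using assms by auto
  then have "Poly_Mapping.lookup v (Suc r) = 0" by (simp add: in_keys_iff)
  then have "Jideal (Suc r) (\<gamma>(Suc r := \<gamma>1)) v = Jideal r \<gamma> v"
    by (auto simp: Jideal_def atLeastAtMostSuc_conv zero_enat_def[symmetric])
  then show ?thesis by (simp add: hfun_def)
qed

section \<open>Forgetting a component\<close>

theorem mainTheorem6:
  fixes r :: nat
    and B :: "nat \<Rightarrow> (complex \<times> complex) set"
    and \<gamma> :: "nat \<Rightarrow> complex \<Rightarrow> complex \<times> complex"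
  assumes "r \<ge> 1"
    and "reduced_curve r B"
    and "\<And>k. k \<in> {1..r} \<Longrightarrow> uniformization (\<gamma> k) (B k)"
  shows "finite {v. reduced_Pg_series r \<gamma> v \<noteq> 0}
    \<and> (\<forall>C1 \<gamma>1. irreducible_curve C1 \<longrightarrow> reduced_curve (r + 1) (B(r + 1 := C1)) \<longrightarrow>
          uniformization \<gamma>1 C1 \<longrightarrow>
          finite {v. reduced_Pg_series (r + 1) (\<gamma>(r + 1 := \<gamma>1)) v \<noteq> 0}
          \<and> subst_one (r + 1) (reduced_Pg (r + 1) (\<gamma>(r + 1 := \<gamma>1)))
              = coeff_const (1 - qq) * reduced_Pg r \<gamma>)
    \<and> (r = 1 \<longrightarrow> subst_one 1 (reduced_Pg r \<gamma>) = 1)"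
proof (intro conjI allI impI)
  obtain N where N: "hilbert_fun r (hfun r \<gamma>) N"
    using ex_hilbert_fun[OF assms(2,3)] by blast
  show "finite {v. reduced_Pg_series r \<gamma> v \<noteq> 0}"
    by (rule finite_reduced_Pg_series[OF assms(1) N])
  show "subst_one 1 (reduced_Pg r \<gamma>) = 1" if "r = 1"
    using N hfun_0[of r \<gamma>] uniformization_germ_arc assms(3) that subst_one_reduced_Pg_1 by blast
  fix C1 \<gamma>1
  assume red: "reduced_curve (r + 1) (B(r + 1 := C1))" and C1: "uniformization \<gamma>1 C1"
  have uni: "uniformization ((\<gamma>(r + 1 := \<gamma>1)) k) ((B(r + 1 := C1)) k)" if "k \<in> {1..r + 1}" for k
    using assms(3)[of k] C1 that by auto
  obtain N' where N': "hilbert_fun (r + 1) (hfun (r + 1) (\<gamma>(r + 1 := \<gamma>1))) N'"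
    using ex_hilbert_fun[OF red uni] by blast
  show "finite {v. reduced_Pg_series (r + 1) (\<gamma>(r + 1 := \<gamma>1)) v \<noteq> 0}"
    by (rule finite_reduced_Pg_series[OF _ N']) simp
  show "subst_one (r + 1) (reduced_Pg (r + 1) (\<gamma>(r + 1 := \<gamma>1))) = coeff_const (1 - qq) * reduced_Pg r \<gamma>"
    using subst_one_reduced_Pg[OF assms(1) N N'[simplified]] hfun_forget by simp
qed

end
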